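(* Let $Z=(Z_t)_{t\in[0,T]}$ be an $\mathbb{R}^{d_z}$-valued information path with an adapted geometric rough-path lift $\mathbf Z$, and let $P_t=\pi_P Z_t\in\mathbb{R}^n$ be the unaffected prices. Let $x_t\in\mathbb{R}^m$ be the coordinate vector of the truncated signature $S^{\le N}(\mathbf Z)_{0,t}$, and set $y_t:=\int_0^t x_u\,\mathrm{d}u$. Suppose that the standing assumptions (lift, integrability, admissibility and exogeneity) listed in the context hold. Let $$\alpha_t=Kx_t,\qquad v_t=Bx_t,\qquad Q_t=Q_0+\int_0^t v_u\,\mathrm{d}u,$$ where $K\in\mathbb{R}^{n\times m}$ is fixed and deterministic, $B\in\mathbb{R}^{n\times m}$ is deterministic (the matrix to be optimised), and $Q_0\in\mathbb{R}^n$ is deterministic. Let $\tilde\Lambda\in\mathbb{R}^{n\times n}$ be symmetric positive definite, let $\Sigma\in\mathbb{R}^{n\times n}$ be symmetric positive semidefinite, and let $\phi,\eta,\gamma\ge 0$. Consider $$J(B):=\mathbb{E}\Big[\int_0^T\Big(Q_t^\top\alpha_t-v_t^\top\tilde\Lambda v_t-\phi\,Q_t^\top\Sigma Q_t-\eta\,(Q_t^\top P_t)^2\Big)\mathrm{d}t-\gamma\|Q_T\|^2\Big].$$ Let $\theta:=\operatorname{vec}(B)\in\mathbb{R}^{nm}$ be the column-major vectorisation of $B$. Then there exist a symmetric matrix $A\in\mathbb{R}^{nm\times nm}$, a vector $b\in\mathbb{R}^{nm}$ and a scalar $c\in\mathbb{R}$ (not depending on $B$) such that the objective, viewed as a function of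 $\theta$, is $$J(\theta)=\theta^\top A\theta+b^\top\theta+c .$$ Furthermore, $A,b,c$ are deterministic and given by $$A=-\mathbb{E}\Big[\int_0^T(x_tx_t^\top)\otimes\tilde\Lambda\,\mathrm{d}t+\int_0^T(y_ty_t^\top)\otimes\big(\phi\Sigma+\eta P_tP_t^\top\big)\,\mathrm{d}t+\gamma\,(y_Ty_T^\top)\otimes I_n\Big],$$ $$b=\mathbb{E}\Big[\int_0^T y_t\otimes\big(Kx_t-2\phi\Sigma Q_0-2\eta P_tP_t^\top Q_0\big)\,\mathrm{d}t-2\gamma\,(y_T\otimes Q_0)\Big],$$ $$c=\mathbb{E}\Big[\int_0^T\big(Q_0^\top Kx_t-\phi\,Q_0^\top\Sigma Q_0-\eta\,(Q_0^\top P_t)^2\big)\,\mathrm{d}t-\gamma\|Q_0\|^2\Big],$$ where $I_n$ is the $n\times n$ identity matrix and $\otimes$ is the Kronecker product.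
   Context: Fix $T>0$ and a filtered probability space $(\Omega,\mathcal F,(\mathcal F_t)_{t\in[0,T]},\mathbb{P})$ satisfying the usual conditions. The information path $Z_t\in\mathbb{R}^{d_z}$, $t\in[0,T]$, is continuous and adapted. The unaffected mid-prices of the $n$ assets are $P_t=\pi_P Z_t\in\mathbb{R}^n$, where $\pi_P:\mathbb{R}^{d_z}\to\mathbb{R}^n$ is a fixed (linear) projection. Signature features. For a truncation level $N\in\mathbb{N}$, let $\mathcal T^{\le N}(\mathbb{R}^{d_z})=\bigoplus_{k=0}^N(\mathbb{R}^{d_z})^{\otimes k}$. The truncated signature $S^{\le N}(\mathbf Z)_{0,t}\in\mathcal T^{\le N}(\mathbb{R}^{d_z})$ is the collection of iterated integrals $S^I(\mathbf Z)_{0,t}=\int_{0<u_1<\dots<u_k<t}\circ\,\mathrm{d}Z^{i_1}_{u_1}\cdots\circ\mathrm{d}Z^{i_k}_{u_k}$ over words $I=(i_1,\dots,i_k)$ in the letters $\{1,\dots,d_z\}$ with $k\le N$. The level-0 entry is $1$. The iterated integrals are those of the chosen lift $\mathbf Z$, given above its defining levels by Lyons' extension. After fixing a basis of $\mathcal T^{\le N}(\mathbb{R}^{d_z})$, $x_t\in\mathbb{R}^m$ with $m=\dim\mathcal T^{\le N}(\mathbb{R}^{d_z})$ is the coordinate vector of $S^{\le N}(\mathbf Z)_{0,t}$, and $y_t=\int_0^t x_u\,\mathrm{d}u$. Standing assumptions. (1) Lift: $Z$ comes with a chosen $(\mathcal F_t)$-adapted geometric rough-path lift $\mathbf Z=(1,\mathbf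 Z^1,\dots,\mathbf Z^{\lfloor p\rfloor})$ of finite $p$-variation for some $p\ge1$, with $\mathbf Z^1_{s,t}=Z_t-Z_s$. (2) Integrability: $\mathbb{E}[\int_0^T\|x_t\|^2\,\mathrm{d}t]<\infty$ and $\mathbb{E}[\int_0^T\|P_t\|^2\|y_t\|^2\,\mathrm{d}t]<\infty$. (3) Admissibility and exogeneity: $v$ is progressively measurable with $\mathbb{E}[\int_0^T\|v_t\|^2\,\mathrm{d}t]<\infty$, and the law of $Z$ does not depend on the choice of $B$. Conventions. $\operatorname{vec}$ stacks columns, so $w^\top Bu=\operatorname{vec}(B)^\top(u\otimes w)$ for $u\in\mathbb{R}^m$, $w\in\mathbb{R}^n$.
   Formalization: For truncation level N=0 only, it is additionally assumed that E∫_0^T η(Q_0^T P_t)^2 dt is finite; without this the scalar c can be minus infinity. For N≥1 no assumption is added. *)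

theory Defs
  imports "HOL-Probability.Probability"
begin

text \<open>Stochastic basis on the time interval \<open>[0, T]\<close>. Only the values \<open>F t\<close> with
  \<open>0 \<le> t \<le> T\<close> matter.\<close>

definition usual_conditions :: "real \<Rightarrow> 'w measure \<Rightarrow> (real \<Rightarrow> 'w measure) \<Rightarrow> bool" where
  "usual_conditions T M F \<longleftrightarrow>
     prob_space M \<and> complete_measure M \<and>
     (\<forall>t\<in>{0..T}. subalgebra M (F t)) \<and>
     (\<forall>s t. 0 \<le> s \<and> s \<le> t \<and> t \<le> T \<longrightarrow> sets (F s) \<subseteq> sets (F t)) \<and>
     null_sets M \<subseteq> sets (F 0) \<and>
     (\<forall>t\<in>{0..<T}. sets (F t) = (\<Inter>s\<in>{t<..T}. sets (F s)))"

definition adapted :: "real \<Rightarrow> (real \<Rightarrow> 'w measure) \<Rightarrow> (real \<Rightarrow> 'w \<Rightarrow> 'b::topological_space) \<Rightarrow> bool" where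
  "adapted T F X \<longleftrightarrow> (\<forall>t\<in>{0..T}. X t \<in> borel_measurable (F t))"

definition progressively_measurable ::
    "real \<Rightarrow> (real \<Rightarrow> 'w measure) \<Rightarrow> (real \<Rightarrow> 'w \<Rightarrow> 'b::topological_space) \<Rightarrow> bool" where
  "progressively_measurable T F X \<longleftrightarrow>
     (\<forall>t\<in>{0..T}. (\<lambda>(s, \<omega>). X s \<omega>) \<in> borel_measurable (restrict_space borel {0..t} \<Otimes>\<^sub>M F t))"

text \<open>The finiteness of \<open>E (\<integral>\<^sub>0\<^sup>T f t dt)\<close> for a nonnegative \<open>f\<close>.\<close>

definition finite_expected_time_integral :: "real \<Rightarrow> 'w measure \<Rightarrow> (real \<Rightarrow> 'w \<Rightarrow> real) \<Rightarrow> bool" where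
  "finite_expected_time_integral T M f \<longleftrightarrow>
     (\<integral>\<^sup>+ \<omega>. (\<integral>\<^sup>+ t\<in>{0..T}. ennreal (f t \<omega>) \<partial>lborel) \<partial>M) < \<infinity>"

definition admissible ::
    "real \<Rightarrow> 'w measure \<Rightarrow> (real \<Rightarrow> 'w measure) \<Rightarrow> (real \<Rightarrow> 'w \<Rightarrow> real ^ 'n) \<Rightarrow> bool" where
  "admissible T M F v \<longleftrightarrow>
     progressively_measurable T F v \<and>
     finite_expected_time_integral T M (\<lambda>t \<omega>. (norm (v t \<omega>))\<^sup>2)"

text \<open>Tensor series over \<open>\<real>\<^sup>d\<close> are functions on words, i.e. lists of letters from the finite
  type \<open>'d\<close>. A two-parameter functional \<open>X\<close> is evaluated as \<open>X s t w\<close>, the coefficient at the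
  word \<open>w\<close> of its value at \<open>(s, t)\<close>; only \<open>0 \<le> s \<le> t \<le> T\<close> matters, and in the notions
  of level \<open>L\<close> only words of length at most \<open>L\<close>.\<close>

type_synonym 'd tensor = "'d list \<Rightarrow> real"
type_synonym 'd functional = "real \<Rightarrow> real \<Rightarrow> 'd tensor"

definition level_norm :: "nat \<Rightarrow> ('d::finite) tensor \<Rightarrow> real" where
  "level_norm k f = sqrt (\<Sum>w | length w = k. (f w)\<^sup>2)"

text \<open>The last product is the word-\<open>w\<close> coefficient of \<open>X s u \<otimes> X u t\<close> (Chen's identity).\<close>

definition multiplicative :: "real \<Rightarrow> nat \<Rightarrow> 'd functional \<Rightarrow> bool" where
  "multiplicative T L X \<longleftrightarrow>
     (\<forall>s t. 0 \<le> s \<and> s \<le> t \<and> t \<le> T \<longrightarrow> X s t [] = 1) \<and>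
     (\<forall>s u t w. 0 \<le> s \<and> s \<le> u \<and> u \<le> t \<and> t \<le> T \<and> length w \<le> L \<longrightarrow>
        X s t w = (\<Sum>i\<le>length w. X s u (take i w) * X u t (drop i w)))"

definition continuous_functional :: "real \<Rightarrow> nat \<Rightarrow> 'd functional \<Rightarrow> bool" where
  "continuous_functional T L X \<longleftrightarrow>
     (\<forall>w. length w \<le> L \<longrightarrow>
        continuous_on {(s, t). 0 \<le> s \<and> s \<le> t \<and> t \<le> T} (\<lambda>(s, t). X s t w))"

text \<open>The \<open>(p/k)\<close>-variation of the level-\<open>k\<close> component, without the outer root: the supremum of
  \<open>\<Sum>\<^sub>i |X\<^sup>k(\<tau>\<^sub>i, \<tau>\<^sub>i\<^sub>+\<^sub>1)|\<^bsup>p/k\<^esup>\<close> over all finite partitions.\<close>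

definition level_variation :: "real \<Rightarrow> real \<Rightarrow> nat \<Rightarrow> ('d::finite) functional \<Rightarrow> ennreal" where
  "level_variation T p k X =
     (SUP (r, \<tau>) \<in> {(r::nat, \<tau>::nat \<Rightarrow> real). mono \<tau> \<and> range \<tau> \<subseteq> {0..T}}.
        ennreal (\<Sum>i<r. level_norm k (X (\<tau> i) (\<tau> (Suc i))) powr (p / real k)))"

text \<open>Continuous multiplicative functionals of degree \<open>L\<close> and finite \<open>p\<close>-variation. For
  \<open>L = \<lfloor>p\<rfloor>\<close> these are the \<open>p\<close>-rough paths.\<close>

definition finite_variation_functional :: "real \<Rightarrow> real \<Rightarrow> nat \<Rightarrow> ('d::finite) functional \<Rightarrow> bool" where
  "finite_variation_functional T p L X \<longleftrightarrow>
     multiplicative T L X \<and> continuous_functional T L X \<and>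
     (\<forall>k\<in>{1..L}. level_variation T p k X < \<infinity>)"

definition rough_path :: "real \<Rightarrow> real \<Rightarrow> ('d::finite) functional \<Rightarrow> bool" where
  "rough_path T p X \<longleftrightarrow> finite_variation_functional T p (nat \<lfloor>p\<rfloor>) X"

text \<open>Geometric rough paths in the sense of Lyons: the limits in the \<open>p\<close>-variation distance of
  (the degree-\<open>\<lfloor>p\<rfloor>\<close> extensions of) 1-rough paths, i.e. of signatures of continuous paths of
  bounded variation. Convergence in the distance
  \<open>max\<^sub>k (level_variation T p k (X - Y))\<^bsup>k/p\<^esup>\<close> is convergence of each level variation to 0.\<close>

definition geometric_rough_path :: "real \<Rightarrow> real \<Rightarrow> ('d::finite) functional \<Rightarrow> bool" where
  "geometric_rough_path T p X \<longleftrightarrow>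
     rough_path T p X \<and>
     (\<exists>Y :: nat \<Rightarrow> 'd functional.
        (\<forall>j. finite_variation_functional T 1 (nat \<lfloor>p\<rfloor>) (Y j)) \<and>
        (\<forall>k\<in>{1..nat \<lfloor>p\<rfloor>}.
           (\<lambda>j. level_variation T p k (\<lambda>s t w. Y j s t w - X s t w)) \<longlonglongrightarrow> 0))"

text \<open>\<open>S\<close> is the signature of the \<open>p\<close>-rough path \<open>X\<close> up to level \<open>N\<close>. Above level \<open>\<lfloor>p\<rfloor>\<close> this
  is Lyons' extension, the unique continuous multiplicative functional of finite \<open>p\<close>-variation
  which extends \<open>X\<close>; for \<open>N \<le> \<lfloor>p\<rfloor>\<close> it is the truncation of \<open>X\<close>.\<close>

definition signature_of :: "real \<Rightarrow> real \<Rightarrow> nat \<Rightarrow> ('d::finite) functional \<Rightarrow> 'd functional \<Rightarrow> bool" where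
  "signature_of T p N X S \<longleftrightarrow>
     finite_variation_functional T p N S \<and>
     (\<forall>s t w. 0 \<le> s \<and> s \<le> t \<and> t \<le> T \<and> length w \<le> min N (nat \<lfloor>p\<rfloor>) \<longrightarrow> S s t w = X s t w)"

definition truncated_tensors :: "nat \<Rightarrow> 'd tensor set" where
  "truncated_tensors N = {f. \<forall>w. N < length w \<longrightarrow> f w = 0}"

definition truncate :: "nat \<Rightarrow> 'd tensor \<Rightarrow> 'd tensor" where
  "truncate N f = (\<lambda>w. if length w \<le> N then f w else 0)"

text \<open>A basis of the truncated tensor algebra indexed by the finite type \<open>'m\<close>; its existence
  forces \<open>CARD('m)\<close> to be the dimension of that algebra.\<close>

definition is_tensor_basis :: "nat \<Rightarrow> ('m::finite \<Rightarrow> 'd tensor) \<Rightarrow> bool" where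
  "is_tensor_basis N e \<longleftrightarrow>
     range e \<subseteq> truncated_tensors N \<and>
     (\<forall>f\<in>truncated_tensors N. \<exists>!c :: real ^ 'm. f = (\<lambda>w. \<Sum>j\<in>UNIV. c $ j * e j w))"

definition tensor_coords :: "('m::finite \<Rightarrow> 'd tensor) \<Rightarrow> 'd tensor \<Rightarrow> real ^ 'm" where
  "tensor_coords e f = (THE c. f = (\<lambda>w. \<Sum>j\<in>UNIV. c $ j * e j w))"

text \<open>Matrices in \<open>\<real>\<^bsup>n\<times>m\<^esup>\<close> have type \<open>real ^ 'm ^ 'n\<close>, and \<open>\<real>\<^bsup>nm\<^esup>\<close> is indexed by pairs
  (column, row) in \<open>'m \<times> 'n\<close>: with the column as the leading index, the lexicographic
  order on pairs is the column-major order.\<close>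

definition colvec :: "real ^ 'm ^ 'n \<Rightarrow> real ^ ('m \<times> 'n)" where
  "colvec B = (\<chi> q. B $ snd q $ fst q)"

definition kron_vec :: "real ^ 'm \<Rightarrow> real ^ 'n \<Rightarrow> real ^ ('m \<times> 'n)" where
  "kron_vec u w = (\<chi> q. u $ fst q * w $ snd q)"

definition kron_mat :: "real ^ 'm ^ 'm \<Rightarrow> real ^ 'n ^ 'n \<Rightarrow> real ^ ('m \<times> 'n) ^ ('m \<times> 'n)" where
  "kron_mat C D = (\<chi> q r. C $ fst q $ fst r * D $ snd q $ snd r)"

definition outer :: "real ^ 'm \<Rightarrow> real ^ 'm ^ 'm" where
  "outer u = (\<chi> i j. u $ i * u $ j)"

lemma colvec_convention:
  fixes B :: "real ^ 'm ^ 'n"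
  shows "w \<bullet> (B *v u) = colvec B \<bullet> kron_vec u w"
proof -
  have "colvec B \<bullet> kron_vec u w = (\<Sum>q\<in>UNIV \<times> UNIV. B $ snd q $ fst q * (u $ fst q * w $ snd q))"
    by (simp add: inner_vec_def colvec_def kron_vec_def)
  also have "\<dots> = (\<Sum>j\<in>UNIV. \<Sum>i\<in>UNIV. B $ i $ j * (u $ j * w $ i))"
    by (simp add: sum.cartesian_product case_prod_unfold)
  also have "\<dots> = (\<Sum>i\<in>UNIV. \<Sum>j\<in>UNIV. B $ i $ j * (u $ j * w $ i))"
    by (rule sum.swap)
  also have "\<dots> = w \<bullet> (B *v u)"
    by (simp add: inner_vec_def matrix_vector_mult_def sum_distrib_left mult_ac)
  finally show ?thesis by simp
qed

definition sym_pos_def :: "real ^ 'n ^ 'n \<Rightarrow> bool" where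
  "sym_pos_def C \<longleftrightarrow> transpose C = C \<and> (\<forall>u. u \<noteq> 0 \<longrightarrow> u \<bullet> (C *v u) > 0)"

definition sym_pos_semidef :: "real ^ 'n ^ 'n \<Rightarrow> bool" where
  "sym_pos_semidef C \<longleftrightarrow> transpose C = C \<and> (\<forall>u. u \<bullet> (C *v u) \<ge> 0)"

definition inventory ::
    "real ^ 'n \<Rightarrow> (real \<Rightarrow> 'w \<Rightarrow> real ^ 'n) \<Rightarrow> real \<Rightarrow> 'w \<Rightarrow> real ^ 'n" where
  "inventory Q0 v t \<omega> = Q0 + (LINT u:{0..t}|lborel. v u \<omega>)"

definition payoff ::
    "real \<Rightarrow> real ^ 'n ^ 'n \<Rightarrow> real ^ 'n ^ 'n \<Rightarrow> real \<Rightarrow> real \<Rightarrow> real \<Rightarrow> real ^ 'n \<Rightarrow>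
     (real \<Rightarrow> 'w \<Rightarrow> real ^ 'n) \<Rightarrow> (real \<Rightarrow> 'w \<Rightarrow> real ^ 'n) \<Rightarrow> (real \<Rightarrow> 'w \<Rightarrow> real ^ 'n) \<Rightarrow> 'w \<Rightarrow> real" where
  "payoff T \<Lambda> \<Sigma>' \<phi> \<eta> \<gamma> Q0 P \<alpha> v \<omega> =
     (LINT t:{0..T}|lborel.
        inventory Q0 v t \<omega> \<bullet> \<alpha> t \<omega>
        - v t \<omega> \<bullet> (\<Lambda> *v v t \<omega>)
        - \<phi> * (inventory Q0 v t \<omega> \<bullet> (\<Sigma>' *v inventory Q0 v t \<omega>))
        - \<eta> * (inventory Q0 v t \<omega> \<bullet> P t \<omega>)\<^sup>2)
     - \<gamma> * (norm (inventory Q0 v T \<omega>))\<^sup>2"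

text \<open>The random variables whose expectations are \<open>- A\<close>, \<open>b\<close> and \<open>c\<close>.\<close>

definition quadratic_rv ::
    "real \<Rightarrow> real ^ 'n ^ 'n \<Rightarrow> real ^ 'n ^ 'n \<Rightarrow> real \<Rightarrow> real \<Rightarrow> real \<Rightarrow>
     (real \<Rightarrow> 'w \<Rightarrow> real ^ 'n) \<Rightarrow> (real \<Rightarrow> 'w \<Rightarrow> real ^ 'm) \<Rightarrow> (real \<Rightarrow> 'w \<Rightarrow> real ^ 'm) \<Rightarrow>
     'w \<Rightarrow> real ^ ('m \<times> 'n) ^ ('m \<times> 'n)" where
  "quadratic_rv T \<Lambda> \<Sigma>' \<phi> \<eta> \<gamma> P x y \<omega> =
     (LINT t:{0..T}|lborel. kron_mat (outer (x t \<omega>)) \<Lambda>)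
     + (LINT t:{0..T}|lborel. kron_mat (outer (y t \<omega>)) (\<phi> *\<^sub>R \<Sigma>' + \<eta> *\<^sub>R outer (P t \<omega>)))
     + \<gamma> *\<^sub>R kron_mat (outer (y T \<omega>)) (mat 1)"

definition linear_rv ::
    "real \<Rightarrow> real ^ 'n ^ 'n \<Rightarrow> real \<Rightarrow> real \<Rightarrow> real \<Rightarrow> real ^ 'n \<Rightarrow> real ^ 'm ^ 'n \<Rightarrow>
     (real \<Rightarrow> 'w \<Rightarrow> real ^ 'n) \<Rightarrow> (real \<Rightarrow> 'w \<Rightarrow> real ^ 'm) \<Rightarrow> (real \<Rightarrow> 'w \<Rightarrow> real ^ 'm) \<Rightarrow>
     'w \<Rightarrow> real ^ ('m \<times> 'n)" where
  "linear_rv T \<Sigma>' \<phi> \<eta> \<gamma> Q0 K P x y \<omega> =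
     (LINT t:{0..T}|lborel.
        kron_vec (y t \<omega>)
          (K *v x t \<omega> - (2 * \<phi>) *\<^sub>R (\<Sigma>' *v Q0) - (2 * \<eta>) *\<^sub>R (outer (P t \<omega>) *v Q0)))
     - (2 * \<gamma>) *\<^sub>R kron_vec (y T \<omega>) Q0"

definition constant_rv ::
    "real \<Rightarrow> real ^ 'n ^ 'n \<Rightarrow> real \<Rightarrow> real \<Rightarrow> real \<Rightarrow> real ^ 'n \<Rightarrow> real ^ 'm ^ 'n \<Rightarrow>
     (real \<Rightarrow> 'w \<Rightarrow> real ^ 'n) \<Rightarrow> (real \<Rightarrow> 'w \<Rightarrow> real ^ 'm) \<Rightarrow> 'w \<Rightarrow> real" where
  "constant_rv T \<Sigma>' \<phi> \<eta> \<gamma> Q0 K P x \<omega> =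
     (LINT t:{0..T}|lborel.
        Q0 \<bullet> (K *v x t \<omega>) - \<phi> * (Q0 \<bullet> (\<Sigma>' *v Q0)) - \<eta> * (Q0 \<bullet> P t \<omega>)\<^sup>2)
     - \<gamma> * (norm Q0)\<^sup>2"

end

theory Submission
  imports Defs
begin

text \<open>Since \<open>v = B x\<close>, the inventory \<open>Q\<^sub>t = Q\<^sub>0 + B y\<^sub>t\<close> is affine in \<open>B\<close>, so the payoff of a single path is
  a quadratic polynomial in \<open>vec B\<close> with the stated Kronecker coefficients; taking expectations
  gives the claim once each coefficient is integrable. By Cauchy-Schwarz \<open>\<bar>y\<^sub>t\<bar>\<^sup>2 \<le> T \<integral> \<bar>x\<bar>\<^sup>2\<close>, and the
  terms containing \<open>P\<close> are controlled by \<open>\<bar>P\<bar>\<^sup>2\<bar>y\<bar>\<^sup>2\<close> and \<open>(Q\<^sub>0 \<bullet> P)\<^sup>2\<close>. For the latter, integrability is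
  extracted from the first two levels of the signature.\<close>

text \<open>The algebra is elementary; measurability shapes the proof. Paths of \<open>Z\<close> are
  continuous only almost surely, so \<open>P\<close> need not be jointly measurable in outcome and
  time. It is replaced by a jointly measurable \<open>P'\<close> that agrees with it at all times
  off a null set, and completeness of the measure carries measurability of the time integrals back
  to \<open>P\<close>. Joint measurability of \<open>x\<close> comes from the admissibility of
  \<open>B x\<close> for a suitable \<open>B\<close>. The delicate term is
  \<open>\<eta> * (Q0 \<bullet> P t \<omega>)\<^sup>2\<close>, which has no factor \<open>y\<close>.
  Since \<open>y\<close> vanishes at time 0, a bound on |P|^2 |y|^2 is weak there. If
  \<open>N\<close> is at least 1, the increments of \<open>P\<close> are linear in \<open>x\<close>,
  so everything reduces to the single random variable P_0, and late times, where \<open>y\<close> is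
  bounded below, control that one. If \<open>N = 0\<close>, then \<open>x\<close> is almost surely
  constant and says nothing about \<open>P\<close>; integrability of this term is then the
  hypothesis \<open>P_int_N0\<close>.\<close>

section \<open>Kronecker products: norms, symmetry and the action on \<open>colvec B\<close>\<close>

lemma inner_outer:
  fixes u :: "real ^ 'm::finite"
  shows "outer u \<bullet> outer u = (u \<bullet> u)\<^sup>2"
  by (simp add: outer_def inner_vec_def sum_product power2_eq_square mult_ac)

lemma norm_outer:
  fixes u :: "real ^ 'm::finite"
  shows "norm (outer u) = (norm u)\<^sup>2"
  by (simp add: norm_eq_sqrt_inner inner_outer)

lemma norm_kron_vec:
  fixes u :: "real ^ 'm::finite" and w :: "real ^ 'n::finite"
  shows "norm (kron_vec u w) = norm u * norm w"
proof -
  have "kron_vec u w \<bullet> kron_vec u w = (\<Sum>q\<in>UNIV \<times> UNIV. (u $ fst q)\<^sup>2 * (w $ snd q)\<^sup>2)"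
    by (simp add: kron_vec_def inner_vec_def power2_eq_square mult_ac)
  also have "\<dots> = (u \<bullet> u) * (w \<bullet> w)"
    unfolding inner_vec_def sum_product sum.cartesian_product
    by (simp add: case_prod_unfold power2_eq_square)
  finally show ?thesis by (simp add: norm_eq_sqrt_inner real_sqrt_mult)
qed

text \<open>The norm of this matrix type is the Frobenius norm, for which the Kronecker product is
  exactly multiplicative. Together with \<open>norm_outer\<close> this reduces integrability of the
  matrix integrands to scalar majorants in |x|^2, |y|^2 and |P|^2.\<close>

lemma norm_kron_mat:
  fixes C :: "real ^ 'm::finite ^ 'm" and D :: "real ^ 'n::finite ^ 'n"
  shows "norm (kron_mat C D) = norm C * norm D"
proof -
  have "kron_mat C D \<bullet> kron_mat C D = (\<Sum>q\<in>UNIV. \<Sum>r\<in>UNIV.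
      (C $ fst q $ fst r)\<^sup>2 * (D $ snd q $ snd r)\<^sup>2)"
    by (simp add: kron_mat_def inner_vec_def power2_eq_square mult_ac)
  also have "\<dots> = (\<Sum>q\<in>UNIV \<times> UNIV. (C $ fst q \<bullet> C $ fst q) * (D $ snd q \<bullet> D $ snd q))"
  proof (rule sum.cong)
    fix q :: "'m \<times> 'n"
    have "(\<Sum>r\<in>UNIV. (C $ fst q $ fst r)\<^sup>2 * (D $ snd q $ snd r)\<^sup>2) =
        (\<Sum>r\<in>UNIV \<times> UNIV. (C $ fst q $ fst r)\<^sup>2 * (D $ snd q $ snd r)\<^sup>2)" by simp
    also have "\<dots> = (C $ fst q \<bullet> C $ fst q) * (D $ snd q \<bullet> D $ snd q)"
      unfolding inner_vec_def sum_product sum.cartesian_product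
      by (simp add: case_prod_unfold power2_eq_square)
    finally show "(\<Sum>r\<in>UNIV. (C $ fst q $ fst r)\<^sup>2 * (D $ snd q $ snd r)\<^sup>2) =
      (C $ fst q \<bullet> C $ fst q) * (D $ snd q \<bullet> D $ snd q)" .
  qed simp
  also have "\<dots> = (C \<bullet> C) * (D \<bullet> D)"
    unfolding inner_vec_def[of C] inner_vec_def[of D] sum_product sum.cartesian_product
    by (simp add: case_prod_unfold)
  finally show ?thesis by (simp add: norm_eq_sqrt_inner real_sqrt_mult)
qed

lemma transpose_kron_mat_outer:
  assumes "transpose D = D"
  shows "transpose (kron_mat (outer u) D) = kron_mat (outer u) D"
proof -
  have D: "D $ j $ i = D $ i $ j" for i j
    using arg_cong[OF assms, of "\<lambda>C. C $ i $ j"] by (simp add: transpose_def)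
  show ?thesis
    by (simp add: transpose_def kron_mat_def outer_def vec_eq_iff) (metis D mult.commute)
qed

lemma transpose_outer: "transpose (outer u) = outer u"
  by (simp add: transpose_def outer_def vec_eq_iff mult_ac)

lemma outer_mult_vec:
  fixes u :: "real ^ 'n::finite"
  shows "outer u *v w = (u \<bullet> w) *\<^sub>R u"
  by (simp add: outer_def matrix_vector_mult_def inner_vec_def vec_eq_iff sum_distrib_left mult_ac)

text \<open>The case C = u u^T of the identity (C \<otimes> D) vec B = vec (D B C^T): here D B u u^T
  has rank one, and its vectorisation is the Kronecker product of u with D B u.\<close>

lemma kron_mat_outer_mult_colvec:
  fixes B :: "real ^ 'm::finite ^ 'n::finite"
  shows "kron_mat (outer u) D *v colvec B = kron_vec u (D *v (B *v u))"
proof -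
  have "(kron_mat (outer u) D *v colvec B) $ q = kron_vec u (D *v (B *v u)) $ q" for q
  proof -
    have "(kron_mat (outer u) D *v colvec B) $ q =
        (\<Sum>r\<in>UNIV \<times> UNIV. u $ fst q * (D $ snd q $ snd r * (B $ snd r $ fst r * u $ fst r)))"
      by (simp add: matrix_vector_mult_def kron_mat_def outer_def colvec_def mult_ac)
    also have "\<dots> = (\<Sum>j\<in>UNIV. \<Sum>i\<in>UNIV. u $ fst q * (D $ snd q $ i * (B $ i $ j * u $ j)))"
      by (simp add: sum.cartesian_product case_prod_unfold)
    also have "\<dots> = (\<Sum>i\<in>UNIV. \<Sum>j\<in>UNIV. u $ fst q * (D $ snd q $ i * (B $ i $ j * u $ j)))"
      by (rule sum.swap)
    also have "\<dots> = kron_vec u (D *v (B *v u)) $ q"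
      by (simp add: kron_vec_def matrix_vector_mult_def sum_distrib_left)
    finally show ?thesis .
  qed
  then show ?thesis by (simp add: vec_eq_iff)
qed

lemma colvec_kron_mat_outer:
  "colvec B \<bullet> (kron_mat (outer u) D *v colvec B) = (B *v u) \<bullet> (D *v (B *v u))"
  by (simp add: kron_mat_outer_mult_colvec colvec_convention[symmetric] inner_commute)

text \<open>Linear in the matrix while the vector stays fixed; this is what lets the quadratic form
  pass through integrals over time and over outcomes.\<close>

lemma bounded_linear_quadratic_form:
  fixes \<theta> :: "real ^ 'k::finite"
  shows "bounded_linear (\<lambda>C. \<theta> \<bullet> (C *v \<theta>))"
  by (rule linear_conv_bounded_linear[THEN iffD1, OF linearI])
     (simp_all add: matrix_vector_mult_add_rdistrib inner_add_right
        scaleR_matrix_vector_assoc[symmetric])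

lemma bounded_linear_transpose: "bounded_linear (transpose :: real ^ 'k::finite ^ 'l::finite \<Rightarrow> _)"
  by (rule linear_conv_bounded_linear[THEN iffD1, OF linearI])
     (simp_all add: transpose_def vec_eq_iff)

section \<open>Measurability of the matrix operations, complete measures, and Cauchy-Schwarz\<close>

lemma borel_measurable_kron_mat [measurable (raw)]:
  fixes C :: "'a \<Rightarrow> real ^ 'm::finite ^ 'm" and D :: "'a \<Rightarrow> real ^ 'n::finite ^ 'n"
  assumes "C \<in> borel_measurable M" "D \<in> borel_measurable M"
  shows "(\<lambda>z. kron_mat (C z) (D z)) \<in> borel_measurable M"
  by (rule borel_measurable_continuous_Pair[OF assms])
     (unfold kron_mat_def, intro continuous_intros)

lemma borel_measurable_kron_vec [measurable (raw)]:
  fixes u :: "'a \<Rightarrow> real ^ 'm::finite" and w :: "'a \<Rightarrow> real ^ 'n::finite"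
  assumes "u \<in> borel_measurable M" "w \<in> borel_measurable M"
  shows "(\<lambda>z. kron_vec (u z) (w z)) \<in> borel_measurable M"
  by (rule borel_measurable_continuous_Pair[OF assms])
     (unfold kron_vec_def, intro continuous_intros)

lemma borel_measurable_outer [measurable (raw)]:
  fixes u :: "'a \<Rightarrow> real ^ 'm::finite"
  assumes "u \<in> borel_measurable M"
  shows "(\<lambda>z. outer (u z)) \<in> borel_measurable M"
  by (rule borel_measurable_continuous_on[OF _ assms])
     (unfold outer_def, intro continuous_intros)

lemma borel_measurable_matrix_vector_mult [measurable (raw)]:
  fixes u :: "'a \<Rightarrow> real ^ 'm::finite" and C :: "real ^ 'm ^ 'n::finite"
  assumes "u \<in> borel_measurable M"
  shows "(\<lambda>z. C *v u z) \<in> borel_measurable M"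
  by (rule borel_measurable_continuous_on[OF _ assms])
     (unfold matrix_vector_mult_def, intro continuous_intros)

lemma borel_measurable_vecI:
  fixes f :: "'a \<Rightarrow> real ^ 'k::finite"
  assumes A: "\<And>i. (\<lambda>z. f z $ i) \<in> borel_measurable M"
  shows "f \<in> borel_measurable M"
proof (subst borel_measurable_euclidean_space, rule ballI)
  fix b :: "real ^ 'k" assume "b \<in> Basis"
  then obtain i where b: "b = axis i 1" unfolding Basis_vec_def by fastforce
  have "f z \<bullet> b = f z $ i" for z unfolding b by (simp add: inner_axis)
  then show "(\<lambda>z. f z \<bullet> b) \<in> borel_measurable M" by (simp only: A)
qed

text \<open>Preimages under \<open>f\<close> and \<open>g\<close> differ by a subset of a null set,
  which completeness makes measurable. This supplies measurability of random variables built from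
  \<open>P\<close>, which are only almost surely equal to those built from
  \<open>P'\<close>.\<close>

lemma (in complete_measure) borel_measurable_cong_AE_complete:
  fixes f g :: "'a \<Rightarrow> 'b::topological_space"
  assumes f: "f \<in> borel_measurable M" and eq: "AE \<omega> in M. f \<omega> = g \<omega>"
  shows "g \<in> borel_measurable M"
proof (rule measurableI)
  fix A :: "'b set" assume A: "A \<in> sets borel"
  show "g -` A \<inter> space M \<in> sets M"
  proof (rule in_sets_AE)
    show "AE \<omega> in M. \<omega> \<in> f -` A \<inter> space M \<longleftrightarrow> \<omega> \<in> g -` A \<inter> space M"
      using eq by eventually_elim auto
  qed (use f A in auto)
qed simp

lemma (in complete_measure) integrable_cong_AE_complete:
  fixes f g :: "'a \<Rightarrow> 'b::{banach, second_countable_topology}"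
  assumes "integrable M f" "AE \<omega> in M. f \<omega> = g \<omega>"
  shows "integrable M g"
  using integrable_cong_AE[THEN iffD1, OF borel_measurable_integrable[OF assms(1)]
      borel_measurable_cong_AE_complete[OF borel_measurable_integrable[OF assms(1)] assms(2)]
      assms(2) assms(1)] .

lemma (in finite_measure) norm_integral_power2_le:
  fixes f :: "'a \<Rightarrow> 'b::{banach, second_countable_topology}"
  assumes [measurable]: "f \<in> borel_measurable M" and sq: "integrable M (\<lambda>t. (norm (f t))\<^sup>2)"
  shows "integrable M f"
    and "(norm (integral\<^sup>L M f))\<^sup>2 \<le> measure M (space M) * (\<integral>t. (norm (f t))\<^sup>2 \<partial>M)"
proof -
  have n: "integrable M (\<lambda>t. norm (f t))"
    by (rule square_integrable_imp_integrable) (use sq in auto)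
  show f: "integrable M f" by (rule integrable_norm_cancel) (use n in auto)
  define a where "a = (\<integral>t. norm (f t) \<partial>M)"
  define m where "m = measure M (space M)"
  have le: "norm (integral\<^sup>L M f) \<le> a" unfolding a_def by (rule integral_norm_bound)
  \<comment> \<open>Cauchy-Schwarz as nonnegativity of a variance, scaled by the total mass
    \<open>m\<close> to avoid division. The expansion carries a surplus factor \<open>m\<close>,
    which can be cancelled only if \<open>m\<close> is nonzero; for \<open>m = 0\<close> also
    \<open>a = 0\<close>.\<close>
  have "0 \<le> (\<integral>t. (m * norm (f t) - a)\<^sup>2 \<partial>M)" by simp
  also have "\<dots> = (\<integral>t. m\<^sup>2 * (norm (f t))\<^sup>2 - 2 * m * a * norm (f t) + a\<^sup>2 \<partial>M)"
    by (intro Bochner_Integration.integral_cong) (auto simp: power2_diff power_mult_distrib)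
  also have "\<dots> = m\<^sup>2 * (\<integral>t. (norm (f t))\<^sup>2 \<partial>M) - 2 * m * a * a + a\<^sup>2 * m"
    by (simp add: sq n a_def[symmetric] m_def[symmetric])
  also have "\<dots> = m * (m * (\<integral>t. (norm (f t))\<^sup>2 \<partial>M) - a\<^sup>2)"
    by algebra
  finally have *: "0 \<le> m * (m * (\<integral>t. (norm (f t))\<^sup>2 \<partial>M) - a\<^sup>2)" .
  have "a\<^sup>2 \<le> m * (\<integral>t. (norm (f t))\<^sup>2 \<partial>M)"
  proof (cases "m = 0")
    case True
    then have "space M \<in> null_sets M" by (simp add: m_def null_sets_def emeasure_eq_measure)
    then have "AE t in M. norm (f t) = 0" by (rule AE_I') auto
    then have "a = 0" unfolding a_def by (rule integral_eq_zero_AE)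
    then show ?thesis using True by simp
  next
    case False
    then have "m > 0" unfolding m_def by (simp add: zero_less_measure_iff)
    then show ?thesis using * by (simp add: zero_le_mult_iff)
  qed
  then show "(norm (integral\<^sup>L M f))\<^sup>2 \<le> measure M (space M) * (\<integral>t. (norm (f t))\<^sup>2 \<partial>M)"
    unfolding m_def by (rule order_trans[OF power_mono[OF le norm_ge_zero]])
qed

section \<open>Joint measurability and integration over outcome and time\<close>

text \<open>Lebesgue measure is restricted to the interval, rather than used through set integrals,
  so that time becomes a finite measure space. Products put the outcome first and time second:
  integrating out the second variable then leaves a random variable.\<close>

abbreviation time_space :: "real \<Rightarrow> real measure" where
  "time_space T \<equiv> restrict_space lborel {0..T}"

text \<open>Time is rounded down to a grid of mesh T/(n+1). The rounded process takes countably many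
  random variables as its pieces, hence is jointly measurable, and path continuity gives pointwise
  convergence to \<open>X\<close>.\<close>

lemma borel_measurable_pair_continuous_paths:
  fixes X :: "real \<Rightarrow> 'w \<Rightarrow> 'b::metric_space"
  assumes T: "T > 0"
    and meas: "\<And>t. t \<in> {0..T} \<Longrightarrow> X t \<in> borel_measurable M"
    and cont: "\<And>\<omega>. \<omega> \<in> space M \<Longrightarrow> continuous_on {0..T} (\<lambda>t. X t \<omega>)"
  shows "(\<lambda>(\<omega>, t). X t \<omega>) \<in> borel_measurable (M \<Otimes>\<^sub>M time_space T)"
proof (rule borel_measurable_LIMSEQ_metric)
  \<comment> \<open>Grid points are indexed by all integers, the values of the floor function, so
    that the countable gluing rule applies. The clamp keeps every grid point in [0, T], the only
    range where \<open>X t\<close> is known to be measurable and continuous.\<close>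
  define r where "r n k = max 0 (min T (T * real_of_int k / real (Suc n)))" for n k
  define g where "g n t = r n \<lfloor>real (Suc n) * t / T\<rfloor>" for n t
  fix n
  have [measurable]: "(\<lambda>z. X (r n k) (fst z)) \<in> borel_measurable (M \<Otimes>\<^sub>M time_space T)" for k
    by (rule measurable_compose[OF measurable_fst meas]) (use T in \<open>auto simp: r_def\<close>)
  have snd_meas [measurable]: "snd \<in> borel_measurable (M \<Otimes>\<^sub>M time_space T)"
    by (rule measurable_compose[of snd _ "time_space T" "\<lambda>t. t"])
       (simp_all add: measurable_restrict_space1)
  have "(\<lambda>z. X (r n \<lfloor>real (Suc n) * snd z / T\<rfloor>) (fst z))
      \<in> borel_measurable (M \<Otimes>\<^sub>M time_space T)"
    by (rule measurable_compose_countable[where f = "\<lambda>k z. X (r n k) (fst z)"]) measurable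
  then show "(\<lambda>(\<omega>, t). X (g n t) \<omega>) \<in> borel_measurable (M \<Otimes>\<^sub>M time_space T)"
    by (simp add: case_prod_unfold g_def)
next
  define r where "r n k = max 0 (min T (T * real_of_int k / real (Suc n)))" for n k
  define g where "g n t = r n \<lfloor>real (Suc n) * t / T\<rfloor>" for n t
  fix z assume z: "z \<in> space (M \<Otimes>\<^sub>M time_space T)"
  obtain \<omega> t where z_eq: "z = (\<omega>, t)" by (cases z)
  have \<omega>: "\<omega> \<in> space M" and t: "t \<in> {0..T}"
    using z by (auto simp: z_eq space_pair_measure space_restrict_space)
  have dist: "\<bar>g n t - t\<bar> \<le> T / real (Suc n)" for n
  proof -
    define q where "q = real (Suc n) * t / T"
    have t_eq: "t = T * q / real (Suc n)" using T by (simp add: q_def)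
    have fl: "real_of_int \<lfloor>q\<rfloor> \<le> q" "q \<le> real_of_int \<lfloor>q\<rfloor> + 1" by linarith+
    have 1: "T * real_of_int \<lfloor>q\<rfloor> / real (Suc n) \<le> t"
      unfolding t_eq using fl T by (intro divide_right_mono mult_left_mono) auto
    have "t \<le> T * (real_of_int \<lfloor>q\<rfloor> + 1) / real (Suc n)"
      by (subst t_eq, intro divide_right_mono mult_left_mono) (use fl T in auto)
    also have "\<dots> = T * real_of_int \<lfloor>q\<rfloor> / real (Suc n) + T / real (Suc n)"
      by (simp add: add_divide_distrib ring_distribs)
    finally have 2: "t \<le> T * real_of_int \<lfloor>q\<rfloor> / real (Suc n) + T / real (Suc n)" .
    have "g n t = max 0 (min T (T * real_of_int \<lfloor>q\<rfloor> / real (Suc n)))"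
      by (simp add: g_def r_def q_def)
    then show ?thesis using 1 2 t T by (auto simp: max_def min_def abs_if)
  qed
  have "(\<lambda>n. T / real (Suc n)) \<longlonglongrightarrow> 0"
    using LIMSEQ_Suc[OF lim_const_over_n[of T]] by simp
  then have "(\<lambda>n. g n t - t) \<longlonglongrightarrow> 0"
    by (rule Lim_null_comparison[rotated]) (use dist in auto)
  then have lim: "(\<lambda>n. g n t) \<longlonglongrightarrow> t" by (simp add: LIM_zero_iff)
  have "\<forall>n. g n t \<in> {0..T}" using T by (auto simp: g_def r_def)
  then have "(\<lambda>n. X (g n t) \<omega>) \<longlonglongrightarrow> X t \<omega>"
    using continuous_on_tendsto_compose[OF cont[OF \<omega>] lim t] by simp
  then show "(\<lambda>n. (\<lambda>(\<omega>, t). X (g n t) \<omega>) z) \<longlonglongrightarrow> (\<lambda>(\<omega>, t). X t \<omega>) z"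
    by (simp add: z_eq)
qed

locale complete_time_prob = prob_space M + complete_measure M
  for M :: "'w measure" and T :: real +
  assumes T_pos: "T > 0"
begin

abbreviation I :: "real measure" where "I \<equiv> time_space T"

sublocale I: finite_measure I
  by (rule finite_measureI)
     (use T_pos in \<open>simp add: emeasure_restrict_space space_restrict_space\<close>)

sublocale MI: pair_sigma_finite M I ..

lemma space_I: "space I = {0..T}"
  by (simp add: space_restrict_space)

lemma measure_space_I: "measure I (space I) = T"
  using T_pos by (simp add: measure_restrict_space space_I)

lemma set_integral_eq_I:
  fixes f :: "real \<Rightarrow> 'b::{banach, second_countable_topology}"
  shows "(LINT t:{0..T}|lborel. f t) = integral\<^sup>L I f"
  by (simp add: set_lebesgue_integral_def integral_restrict_space)

lemma set_integral_initial_eq_I: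
  fixes f :: "real \<Rightarrow> 'b::{banach, second_countable_topology}"
  assumes "t \<le> T"
  shows "(LINT u:{0..t}|lborel. f u) = (\<integral>u. indicator {0..t} u *\<^sub>R f u \<partial>I)"
  unfolding set_lebesgue_integral_def
  by (subst integral_restrict_space, simp, intro Bochner_Integration.integral_cong)
     (use assms in \<open>auto simp: indicator_def\<close>)

lemma integral_indicator_I:
  assumes "0 \<le> a" "a \<le> b" "b \<le> T"
  shows "(\<integral>u. indicator {a..b} u \<partial>I) = b - a"
proof -
  have "(\<integral>u. indicat_real {a..b} u \<partial>I) = (\<integral>u. indicat_real {a..b} u \<partial>lborel)"
    by (subst integral_restrict_space, simp, intro Bochner_Integration.integral_cong)
       (use assms in \<open>auto simp: indicator_def\<close>)
  then show ?thesis using assms by simp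
qed

text \<open>Discontinuous paths are replaced by 0, so that every path becomes continuous and
  \<open>borel_measurable_pair_continuous_paths\<close> applies. The exceptional set does not depend
  on the time.\<close>

lemma continuous_paths_modification:
  fixes X :: "real \<Rightarrow> 'w \<Rightarrow> 'b::real_normed_vector"
  assumes meas: "\<And>t. t \<in> {0..T} \<Longrightarrow> X t \<in> borel_measurable M"
    and cont: "AE \<omega> in M. continuous_on {0..T} (\<lambda>t. X t \<omega>)"
  obtains X' where "(\<lambda>(\<omega>, t). X' t \<omega>) \<in> borel_measurable (M \<Otimes>\<^sub>M I)"
    and "AE \<omega> in M. \<forall>t\<in>{0..T}. X t \<omega> = X' t \<omega>"
proof
  define G where "G = {\<omega>\<in>space M. continuous_on {0..T} (\<lambda>t. X t \<omega>)}"
  have "G = space M - {\<omega>\<in>space M. \<not> continuous_on {0..T} (\<lambda>t. X t \<omega>)}"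
    by (auto simp: G_def)
  \<comment> \<open>Completeness is essential: path continuity is an uncountable condition, and its
    failure set is measurable here because it lies in a null set.\<close>
  moreover have "{\<omega>\<in>space M. \<not> continuous_on {0..T} (\<lambda>t. X t \<omega>)} \<in> null_sets M"
    using cont by (simp only: AE_iff_null_sets)
  ultimately have G [measurable]: "G \<in> sets M" by auto
  define X' where "X' t \<omega> = (if \<omega> \<in> G then X t \<omega> else 0)" for t \<omega>
  show "(\<lambda>(\<omega>, t). X' t \<omega>) \<in> borel_measurable (M \<Otimes>\<^sub>M I)"
  proof (rule borel_measurable_pair_continuous_paths[OF T_pos])
    fix t assume "t \<in> {0..T}"
    then show "X' t \<in> borel_measurable M"
      unfolding X'_def using meas G by (intro measurable_If_set) auto
  next
    fix \<omega>
    show "continuous_on {0..T} (\<lambda>t. X' t \<omega>)"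
      by (cases "\<omega> \<in> G") (auto simp: X'_def G_def)
  qed
  show "AE \<omega> in M. \<forall>t\<in>{0..T}. X t \<omega> = X' t \<omega>"
    using cont AE_space by eventually_elim (auto simp: X'_def G_def)
qed

lemma nn_set_integral_eq_I:
  "(\<integral>\<^sup>+ t\<in>{0..T}. f t \<partial>lborel) = (\<integral>\<^sup>+ t. f t \<partial>I)"
  by (simp add: nn_integral_restrict_space)

lemma finite_expected_time_integral_cong:
  assumes "AE \<omega> in M. \<forall>t\<in>{0..T}. f t \<omega> = g t \<omega>"
  shows "finite_expected_time_integral T M f \<longleftrightarrow> finite_expected_time_integral T M g"
proof -
  have "(\<integral>\<^sup>+ \<omega>. (\<integral>\<^sup>+ t\<in>{0..T}. ennreal (f t \<omega>) \<partial>lborel) \<partial>M) =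
      (\<integral>\<^sup>+ \<omega>. (\<integral>\<^sup>+ t\<in>{0..T}. ennreal (g t \<omega>) \<partial>lborel) \<partial>M)"
    by (rule nn_integral_cong_AE, use assms in eventually_elim)
       (auto intro!: nn_integral_cong simp: indicator_def)
  then show ?thesis by (simp add: finite_expected_time_integral_def)
qed

text \<open>By Tonelli, the iterated integral of the integrability assumptions becomes one on the
  product space, where all domination arguments take place.\<close>

lemma finite_expected_time_integral_iff_integrable:
  assumes meas: "(\<lambda>(\<omega>, t). f t \<omega>) \<in> borel_measurable (M \<Otimes>\<^sub>M I)"
    and nonneg: "\<And>t \<omega>. 0 \<le> f t \<omega>"
  shows "finite_expected_time_integral T M f \<longleftrightarrow> integrable (M \<Otimes>\<^sub>M I) (\<lambda>(\<omega>, t). f t \<omega>)"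
proof -
  have "(\<integral>\<^sup>+ \<omega>. (\<integral>\<^sup>+ t\<in>{0..T}. ennreal (f t \<omega>) \<partial>lborel) \<partial>M) =
      (\<integral>\<^sup>+ \<omega>. (\<integral>\<^sup>+ t. ennreal (case (\<omega>, t) of (\<omega>, t) \<Rightarrow> f t \<omega>) \<partial>I) \<partial>M)"
    by (simp add: nn_set_integral_eq_I)
  also have "\<dots> = (\<integral>\<^sup>+ z. ennreal (case z of (\<omega>, t) \<Rightarrow> f t \<omega>) \<partial>(M \<Otimes>\<^sub>M I))"
    by (rule I.nn_integral_fst) (use meas in measurable)
  also have "\<dots> = (\<integral>\<^sup>+ z. ennreal (norm (case z of (\<omega>, t) \<Rightarrow> f t \<omega>)) \<partial>(M \<Otimes>\<^sub>M I))"
    using nonneg by (intro nn_integral_cong) (auto split: prod.split)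
  finally show ?thesis
    using meas by (simp add: finite_expected_time_integral_def integrable_iff_bounded)
qed

text \<open>Fubini applies to the jointly measurable \<open>G'\<close>. The time integrals of
  \<open>G\<close> and \<open>G'\<close> agree almost surely, and completeness transfers
  measurability and integrability to \<open>G\<close>.\<close>

lemma integrable_time_integral:
  fixes G :: "real \<Rightarrow> 'w \<Rightarrow> 'b::{banach, second_countable_topology}"
  assumes int: "integrable (M \<Otimes>\<^sub>M I) (\<lambda>(\<omega>, t). G' t \<omega>)"
    and eq: "AE \<omega> in M. \<forall>t\<in>{0..T}. G t \<omega> = G' t \<omega>"
  shows "AE \<omega> in M. integrable I (\<lambda>t. G t \<omega>)"
    and "integrable M (\<lambda>\<omega>. LINT t:{0..T}|lborel. G t \<omega>)"
proof -
  show "AE \<omega> in M. integrable I (\<lambda>t. G t \<omega>)"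
    using MI.AE_integrable_fst'[OF int] eq
  proof eventually_elim
    case (elim \<omega>)
    then show ?case
      by (subst Bochner_Integration.integrable_cong[OF refl, of I _ "\<lambda>t. G' t \<omega>"])
         (auto simp: space_I)
  qed
  have "AE \<omega> in M. (\<integral>t. (case (\<omega>, t) of (\<omega>, t) \<Rightarrow> G' t \<omega>) \<partial>I) = (LINT t:{0..T}|lborel. G t \<omega>)"
    using eq
  proof eventually_elim
    case (elim \<omega>)
    then show ?case unfolding set_integral_eq_I
      by (intro Bochner_Integration.integral_cong) (auto simp: space_I)
  qed
  then show "integrable M (\<lambda>\<omega>. LINT t:{0..T}|lborel. G t \<omega>)"
    by (rule integrable_cong_AE_complete[OF MI.integrable_fst'[OF int]])
qed

text \<open>The upper limit \<open>t\<close> is moved into an indicator, jointly measurable in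
  outcome, \<open>t\<close> and \<open>u\<close>; what remains is a parameter integral over a fixed
  finite measure. No integrability is assumed: the Bochner integral is 0 where it fails, and
  measurability persists.\<close>

lemma borel_measurable_running_integral:
  fixes x :: "real \<Rightarrow> 'w \<Rightarrow> 'b::{banach, second_countable_topology}"
  assumes x: "(\<lambda>(\<omega>, t). x t \<omega>) \<in> borel_measurable (M \<Otimes>\<^sub>M I)"
  shows "(\<lambda>(\<omega>, t). LINT u:{0..t}|lborel. x u \<omega>) \<in> borel_measurable (M \<Otimes>\<^sub>M I)"
proof -
  have [measurable]: "(\<lambda>z. x (snd z) (fst (fst z))) \<in> borel_measurable ((M \<Otimes>\<^sub>M I) \<Otimes>\<^sub>M I)"
    using measurable_compose[of "\<lambda>z. (fst (fst z), snd z)" "(M \<Otimes>\<^sub>M I) \<Otimes>\<^sub>M I" "M \<Otimes>\<^sub>M I", OF _ x]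
    by (simp add: case_prod_unfold)
  have [measurable]: "(\<lambda>t. t) \<in> borel_measurable I"
    by (simp add: measurable_restrict_space1)
  have [measurable]: "(\<lambda>z. snd z) \<in> borel_measurable ((M \<Otimes>\<^sub>M I) \<Otimes>\<^sub>M I)"
    "(\<lambda>z. snd (fst z)) \<in> borel_measurable ((M \<Otimes>\<^sub>M I) \<Otimes>\<^sub>M I)"
    by (rule measurable_compose[of _ _ I "\<lambda>t. t"], measurable)+
  have "(\<lambda>z. indicator {0..snd (fst z)} (snd z) *\<^sub>R x (snd z) (fst (fst z)))
      \<in> borel_measurable ((M \<Otimes>\<^sub>M I) \<Otimes>\<^sub>M I)"
    unfolding indicator_def atLeastAtMost_iff by measurable
  then have "(\<lambda>z. \<integral>u. indicator {0..snd z} u *\<^sub>R x u (fst z) \<partial>I) \<in> borel_measurable (M \<Otimes>\<^sub>M I)"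
    by (intro I.borel_measurable_lebesgue_integral) (simp add: case_prod_unfold)
  then show ?thesis
    by (rule measurable_cong[THEN iffD1, rotated])
       (auto simp: set_integral_initial_eq_I space_pair_measure space_I)
qed

end

section \<open>The payoff of one path as a quadratic polynomial\<close>

lemma inner_matrix_symmetric:
  fixes C :: "real ^ 'n::finite ^ 'n"
  assumes "transpose C = C"
  shows "u \<bullet> (C *v w) = w \<bullet> (C *v u)"
  by (metis assms dot_lmul_matrix inner_commute transpose_matrix_vector)

text \<open>Here \<open>x\<close>, \<open>y\<close>, \<open>\<alpha>\<close> and \<open>P\<close>
  are plain vectors, the values at one time. Symmetry of \<open>\<Sigma>'\<close> merges its two
  cross terms into the factor 2 of the linear part, and (z \<bullet> P)^2 is the quadratic form of
  \<open>outer P\<close>.\<close>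

lemma payoff_integrand_eq:
  fixes B :: "real ^ 'm::finite ^ 'n::finite"
  assumes \<Sigma>': "transpose \<Sigma>' = \<Sigma>'"
  shows "(Q0 + B *v y) \<bullet> \<alpha> - (B *v x) \<bullet> (\<Lambda> *v (B *v x))
      - \<phi> * ((Q0 + B *v y) \<bullet> (\<Sigma>' *v (Q0 + B *v y))) - \<eta> * ((Q0 + B *v y) \<bullet> P)\<^sup>2 =
    (Q0 \<bullet> \<alpha> - \<phi> * (Q0 \<bullet> (\<Sigma>' *v Q0)) - \<eta> * (Q0 \<bullet> P)\<^sup>2)
    + kron_vec y (\<alpha> - (2 * \<phi>) *\<^sub>R (\<Sigma>' *v Q0) - (2 * \<eta>) *\<^sub>R (outer P *v Q0)) \<bullet> colvec B
    - colvec B \<bullet> (kron_mat (outer x) \<Lambda> *v colvec B)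
    - colvec B \<bullet> (kron_mat (outer y) (\<phi> *\<^sub>R \<Sigma>' + \<eta> *\<^sub>R outer P) *v colvec B)"
proof -
  define z where "z = B *v y"
  have 1: "kron_vec y w \<bullet> colvec B = w \<bullet> z" for w
    by (simp add: z_def colvec_convention inner_commute)
  have 2: "colvec B \<bullet> (kron_mat (outer y) D *v colvec B) = z \<bullet> (D *v z)" for D
    by (simp add: z_def colvec_kron_mat_outer)
  have 3: "(\<Sigma>' *v Q0) \<bullet> z = Q0 \<bullet> (\<Sigma>' *v z)" "z \<bullet> (\<Sigma>' *v Q0) = Q0 \<bullet> (\<Sigma>' *v z)"
    using inner_matrix_symmetric[OF \<Sigma>', of Q0 z] by (simp_all add: inner_commute)
  show ?thesis
    unfolding z_def[symmetric] 1 2 colvec_kron_mat_outer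
    by (simp add: matrix_vector_right_distrib matrix_vector_mult_add_rdistrib inner_add_left inner_add_right
        inner_diff_left outer_mult_vec scaleR_matrix_vector_assoc[symmetric] 3 inner_commute[of P z] inner_commute[of P Q0] inner_commute[of \<alpha> z]
        power2_eq_square algebra_simps)
qed

lemma norm_add_mult_vec_power2:
  fixes B :: "real ^ 'm::finite ^ 'n::finite"
  shows "(norm (Q0 + B *v y))\<^sup>2 = (norm Q0)\<^sup>2 + 2 * (kron_vec y Q0 \<bullet> colvec B)
    + colvec B \<bullet> (kron_mat (outer y) (mat 1) *v colvec B)"
proof -
  have "kron_vec y Q0 \<bullet> colvec B = Q0 \<bullet> (B *v y)"
    by (simp add: colvec_convention inner_commute)
  then show ?thesis
    by (simp add: colvec_kron_mat_outer power2_norm_eq_inner inner_add_left inner_add_right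
        inner_commute[of "B *v y" Q0])
qed

context complete_time_prob
begin

lemma inventory_linear_strategy:
  fixes B :: "real ^ 'm::finite ^ 'n::finite"
  assumes x: "integrable I (\<lambda>t. x t \<omega>)" and t: "t \<in> {0..T}"
  shows "inventory Q0 (\<lambda>t \<omega>. B *v x t \<omega>) t \<omega> = Q0 + B *v (LINT u:{0..t}|lborel. x u \<omega>)"
proof -
  have "{0..t} \<in> sets I" using t by (auto simp: sets_restrict_space_iff)
  then have "integrable I (\<lambda>u. indicator {0..t} u *\<^sub>R x u \<omega>)"
    using x by (rule integrable_mult_indicator)
  then have "(\<integral>u. B *v (indicator {0..t} u *\<^sub>R x u \<omega>) \<partial>I) = B *v (\<integral>u. indicator {0..t} u *\<^sub>R x u \<omega> \<partial>I)"
    by (rule integral_bounded_linear[OF matrix_vector_mul_bounded_linear])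
  then show ?thesis
    using t by (simp add: inventory_def set_integral_initial_eq_I matrix_vector_mult_scaleR)
qed

text \<open>A statement about a single path. Each coefficient integrand is assumed integrable on its
  own, since the time integral is split into four pieces and the linear maps C to \<theta> \<bullet>
  C \<theta> and w to w \<bullet> \<theta> are moved outside.\<close>

lemma payoff_linear_strategy:
  fixes B :: "real ^ 'm::finite ^ 'n::finite"
  assumes \<Sigma>': "transpose \<Sigma>' = \<Sigma>'"
    and y: "\<And>t. t \<in> {0..T} \<Longrightarrow> y t \<omega> = (LINT u:{0..t}|lborel. x u \<omega>)"
    and x: "integrable I (\<lambda>t. x t \<omega>)"
    and quad1: "integrable I (\<lambda>t. kron_mat (outer (x t \<omega>)) \<Lambda>)"
    and quad2: "integrable I (\<lambda>t. kron_mat (outer (y t \<omega>)) (\<phi> *\<^sub>R \<Sigma>' + \<eta> *\<^sub>R outer (P t \<omega>)))"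
    and lin: "integrable I (\<lambda>t. kron_vec (y t \<omega>)
        (K *v x t \<omega> - (2 * \<phi>) *\<^sub>R (\<Sigma>' *v Q0) - (2 * \<eta>) *\<^sub>R (outer (P t \<omega>) *v Q0)))"
    and const: "integrable I (\<lambda>t. Q0 \<bullet> (K *v x t \<omega>) - \<phi> * (Q0 \<bullet> (\<Sigma>' *v Q0)) - \<eta> * (Q0 \<bullet> P t \<omega>)\<^sup>2)"
  shows "payoff T \<Lambda> \<Sigma>' \<phi> \<eta> \<gamma> Q0 P (\<lambda>t \<omega>. K *v x t \<omega>) (\<lambda>t \<omega>. B *v x t \<omega>) \<omega> =
    - (colvec B \<bullet> (quadratic_rv T \<Lambda> \<Sigma>' \<phi> \<eta> \<gamma> P x y \<omega> *v colvec B))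
    + linear_rv T \<Sigma>' \<phi> \<eta> \<gamma> Q0 K P x y \<omega> \<bullet> colvec B
    + constant_rv T \<Sigma>' \<phi> \<eta> \<gamma> Q0 K P x \<omega>"
proof -
  let ?v = "\<lambda>t \<omega>. B *v x t \<omega>" and ?\<theta> = "colvec B"
  let ?Q1 = "\<lambda>t. kron_mat (outer (x t \<omega>)) \<Lambda>"
  let ?Q2 = "\<lambda>t. kron_mat (outer (y t \<omega>)) (\<phi> *\<^sub>R \<Sigma>' + \<eta> *\<^sub>R outer (P t \<omega>))"
  let ?L = "\<lambda>t. kron_vec (y t \<omega>)
      (K *v x t \<omega> - (2 * \<phi>) *\<^sub>R (\<Sigma>' *v Q0) - (2 * \<eta>) *\<^sub>R (outer (P t \<omega>) *v Q0))"
  let ?C = "\<lambda>t. Q0 \<bullet> (K *v x t \<omega>) - \<phi> * (Q0 \<bullet> (\<Sigma>' *v Q0)) - \<eta> * (Q0 \<bullet> P t \<omega>)\<^sup>2"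
  let ?q = "\<lambda>C. ?\<theta> \<bullet> (C *v ?\<theta>)"
  have inv: "inventory Q0 ?v t \<omega> = Q0 + B *v y t \<omega>" if "t \<in> {0..T}" for t
    using inventory_linear_strategy[of x \<omega>, OF x that] y[OF that] by simp
  have q: "bounded_linear ?q" by (rule bounded_linear_quadratic_form)
  have l: "bounded_linear (\<lambda>w. w \<bullet> ?\<theta>)" by (rule bounded_linear_inner_left)
  have int: "integrable I (\<lambda>t. ?q (?Q1 t))" "integrable I (\<lambda>t. ?q (?Q2 t))"
    "integrable I (\<lambda>t. ?L t \<bullet> ?\<theta>)"
    using integrable_bounded_linear[OF q quad1] integrable_bounded_linear[OF q quad2]
      integrable_bounded_linear[OF l lin] by simp_all
  have "(LINT t:{0..T}|lborel. inventory Q0 ?v t \<omega> \<bullet> (K *v x t \<omega>) - ?v t \<omega> \<bullet> (\<Lambda> *v ?v t \<omega>)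
        - \<phi> * (inventory Q0 ?v t \<omega> \<bullet> (\<Sigma>' *v inventory Q0 ?v t \<omega>))
        - \<eta> * (inventory Q0 ?v t \<omega> \<bullet> P t \<omega>)\<^sup>2)
      = (\<integral>t. ?C t + ?L t \<bullet> ?\<theta> - ?q (?Q1 t) - ?q (?Q2 t) \<partial>I)"
    unfolding set_integral_eq_I
    by (intro Bochner_Integration.integral_cong refl)
       (simp only: inv space_I payoff_integrand_eq[OF \<Sigma>'])
  also have "\<dots> = integral\<^sup>L I ?C + integral\<^sup>L I ?L \<bullet> ?\<theta> - ?q (integral\<^sup>L I ?Q1) - ?q (integral\<^sup>L I ?Q2)"
    unfolding integral_bounded_linear[OF q quad1, symmetric] integral_bounded_linear[OF q quad2, symmetric]
      integral_bounded_linear[OF l lin, symmetric]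
    using int const by (simp only: Bochner_Integration.integral_add Bochner_Integration.integral_diff
        Bochner_Integration.integrable_add Bochner_Integration.integrable_diff)
  finally have main: "(LINT t:{0..T}|lborel. inventory Q0 ?v t \<omega> \<bullet> (K *v x t \<omega>) - ?v t \<omega> \<bullet> (\<Lambda> *v ?v t \<omega>)
        - \<phi> * (inventory Q0 ?v t \<omega> \<bullet> (\<Sigma>' *v inventory Q0 ?v t \<omega>))
        - \<eta> * (inventory Q0 ?v t \<omega> \<bullet> P t \<omega>)\<^sup>2)
      = integral\<^sup>L I ?C + integral\<^sup>L I ?L \<bullet> ?\<theta> - ?q (integral\<^sup>L I ?Q1) - ?q (integral\<^sup>L I ?Q2)" .
  have "T \<in> {0..T}" using T_pos by simp
  then have "payoff T \<Lambda> \<Sigma>' \<phi> \<eta> \<gamma> Q0 P (\<lambda>t \<omega>. K *v x t \<omega>) ?v \<omega> =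
      integral\<^sup>L I ?C + integral\<^sup>L I ?L \<bullet> ?\<theta> - ?q (integral\<^sup>L I ?Q1) - ?q (integral\<^sup>L I ?Q2)
      - \<gamma> * ((norm Q0)\<^sup>2 + 2 * (kron_vec (y T \<omega>) Q0 \<bullet> ?\<theta>)
      + ?q (kron_mat (outer (y T \<omega>)) (mat 1)))"
    by (simp only: payoff_def main inv norm_add_mult_vec_power2)
  also have "\<dots> = - ?q (quadratic_rv T \<Lambda> \<Sigma>' \<phi> \<eta> \<gamma> P x y \<omega>)
      + linear_rv T \<Sigma>' \<phi> \<eta> \<gamma> Q0 K P x y \<omega> \<bullet> ?\<theta>
      + constant_rv T \<Sigma>' \<phi> \<eta> \<gamma> Q0 K P x \<omega>"
    unfolding quadratic_rv_def linear_rv_def constant_rv_def set_integral_eq_I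
    by (simp add: matrix_vector_mult_add_rdistrib inner_add_right inner_diff_left
        scaleR_matrix_vector_assoc[symmetric] algebra_simps)
  finally show ?thesis .
qed

end

section \<open>Integrability of the coefficients and the expected payoff\<close>

lemma matrix_vector_norm_bound:
  fixes K :: "real ^ 'm::finite ^ 'n::finite"
  obtains k where "k \<ge> 0" "\<And>u. norm (K *v u) \<le> k * norm u"
proof -
  obtain k where "k \<ge> 0" "\<And>u. norm (K *v u) \<le> norm u * k"
    using bounded_linear.nonneg_bounded[OF matrix_vector_mul_bounded_linear[of K]] by blast
  then show thesis by (intro that[of k]) (simp_all add: mult.commute)
qed

context complete_time_prob
begin

text \<open>The pathwise bound on |y_t|^2 is proved uniformly in \<open>t\<close>. Integrability
  over the product space alone would say nothing about the single time \<open>T\<close>, which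
  enters through the terminal penalty.\<close>

lemma running_integral_bounds:
  fixes x :: "real \<Rightarrow> 'w \<Rightarrow> 'b::{banach, second_countable_topology}"
  assumes x: "(\<lambda>(\<omega>, t). x t \<omega>) \<in> borel_measurable (M \<Otimes>\<^sub>M I)"
    and sq: "integrable (M \<Otimes>\<^sub>M I) (\<lambda>(\<omega>, t). (norm (x t \<omega>))\<^sup>2)"
    and y: "y = (\<lambda>t \<omega>. LINT u:{0..t}|lborel. x u \<omega>)"
  shows "AE \<omega> in M. integrable I (\<lambda>t. x t \<omega>)"
    and "integrable (M \<Otimes>\<^sub>M I) (\<lambda>(\<omega>, t). (norm (y t \<omega>))\<^sup>2)"
    and "integrable M (\<lambda>\<omega>. (norm (y T \<omega>))\<^sup>2)"
    and "y T \<in> borel_measurable M"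
proof -
  define X where "X \<omega> = (\<integral>t. (norm (x t \<omega>))\<^sup>2 \<partial>I)" for \<omega>
  have ym: "(\<lambda>(\<omega>, t). y t \<omega>) \<in> borel_measurable (M \<Otimes>\<^sub>M I)"
    unfolding y by (rule borel_measurable_running_integral[OF x])
  have T: "T \<in> space I" using T_pos by (simp add: space_I)
  show yT: "y T \<in> borel_measurable M"
    using measurable_compose[OF measurable_Pair2'[OF T] ym] by (simp add: eta_contract_eq)
  have intX: "integrable M X"
    using MI.integrable_fst'[OF sq] by (simp add: X_def[abs_def])
  have sections: "(\<lambda>t. x t \<omega>) \<in> borel_measurable I" if "\<omega> \<in> space M" for \<omega>
    using measurable_compose[OF measurable_Pair1'[OF that] x] by simp
  have good: "AE \<omega> in M. (\<lambda>t. x t \<omega>) \<in> borel_measurable I \<and> integrable I (\<lambda>t. (norm (x t \<omega>))\<^sup>2)"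
    using MI.AE_integrable_fst'[OF sq] AE_space by eventually_elim (simp add: sections)
  then show "AE \<omega> in M. integrable I (\<lambda>t. x t \<omega>)"
    by eventually_elim (rule I.norm_integral_power2_le, auto)
  have bound: "AE \<omega> in M. \<forall>t\<in>{0..T}. (norm (y t \<omega>))\<^sup>2 \<le> T * X \<omega>"
    using good
  proof eventually_elim
    case (elim \<omega>)
    show ?case
    proof
      fix t assume t: "t \<in> {0..T}"
      \<comment> \<open>Cutting \<open>x\<close> off after \<open>t\<close> gives an integral over
        all of [0, T], so Cauchy-Schwarz yields the same constant \<open>T\<close> for every
        \<open>t\<close>.\<close>
      let ?f = "\<lambda>u. indicator {0..t} u *\<^sub>R x u \<omega>"
      have A: "{0..t} \<in> sets I" using t by (auto simp: sets_restrict_space_iff)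
      have m: "?f \<in> borel_measurable I" using elim A by auto
      have le: "(norm (?f u))\<^sup>2 \<le> (norm (x u \<omega>))\<^sup>2" for u by (simp add: indicator_def)
      have i: "integrable I (\<lambda>u. (norm (?f u))\<^sup>2)"
        by (rule Bochner_Integration.integrable_bound[OF elim[THEN conjunct2]])
           (use m in measurable, use le in simp)
      have "(norm (y t \<omega>))\<^sup>2 \<le> T * (\<integral>u. (norm (?f u))\<^sup>2 \<partial>I)"
        using I.norm_integral_power2_le(2)[OF m i] t
        by (simp only: y set_integral_initial_eq_I measure_space_I atLeastAtMost_iff)
      also have "\<dots> \<le> T * X \<omega>"
        unfolding X_def using T_pos elim i le by (intro mult_left_mono integral_mono) auto
      finally show "(norm (y t \<omega>))\<^sup>2 \<le> T * X \<omega>" .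
    qed
  qed
  have y2m: "(\<lambda>(\<omega>, t). (norm (y t \<omega>))\<^sup>2) \<in> borel_measurable (M \<Otimes>\<^sub>M I)"
    using ym by (simp add: case_prod_unfold)
  have y_sections: "(\<lambda>t. (norm (y t \<omega>))\<^sup>2) \<in> borel_measurable I" if "\<omega> \<in> space M" for \<omega>
    using measurable_compose[OF measurable_Pair1'[OF that] y2m] by simp
  have y_int: "AE \<omega> in M. integrable I (\<lambda>t. (norm (y t \<omega>))\<^sup>2)"
    using bound AE_space
  proof eventually_elim
    case (elim \<omega>)
    then show ?case
      by (intro I.integrable_const_bound[where B="T * X \<omega>"] AE_I2 y_sections)
         (auto simp: space_I)
  qed
  show "integrable (M \<Otimes>\<^sub>M I) (\<lambda>(\<omega>, t). (norm (y t \<omega>))\<^sup>2)"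
  proof (rule MI.Fubini_integrable[OF y2m])
    \<comment> \<open>One factor \<open>T\<close> comes from Cauchy-Schwarz, the other from
      integrating that bound over [0, T].\<close>
    have "integrable M (\<lambda>\<omega>. T * (T * X \<omega>))" using intX by simp
    then show "integrable M (\<lambda>\<omega>. \<integral>t. norm (case (\<omega>, t) of (\<omega>, t) \<Rightarrow> (norm (y t \<omega>))\<^sup>2) \<partial>I)"
    proof (rule Bochner_Integration.integrable_bound)
      show "(\<lambda>\<omega>. \<integral>t. norm (case (\<omega>, t) of (\<omega>, t) \<Rightarrow> (norm (y t \<omega>))\<^sup>2) \<partial>I) \<in> borel_measurable M"
        by (rule I.borel_measurable_lebesgue_integral) (use y2m in \<open>simp add: case_prod_unfold\<close>)
      show "AE \<omega> in M. norm (\<integral>t. norm (case (\<omega>, t) of (\<omega>, t) \<Rightarrow> (norm (y t \<omega>))\<^sup>2) \<partial>I)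
          \<le> norm (T * (T * X \<omega>))"
        using bound y_int
      proof eventually_elim
        case (elim \<omega>)
        have "(\<integral>t. (norm (y t \<omega>))\<^sup>2 \<partial>I) \<le> (\<integral>t. T * X \<omega> \<partial>I)"
          using elim by (intro integral_mono) (auto simp: space_I)
        also have "\<dots> = T * (T * X \<omega>)" using measure_space_I by (simp add: space_I)
        finally show ?case by simp
      qed
    qed
  qed (use y_int in simp)
  have "integrable M (\<lambda>\<omega>. T * X \<omega>)" using intX by simp
  then show "integrable M (\<lambda>\<omega>. (norm (y T \<omega>))\<^sup>2)"
  proof (rule Bochner_Integration.integrable_bound)
    show "AE \<omega> in M. norm ((norm (y T \<omega>))\<^sup>2) \<le> norm (T * X \<omega>)"
      using bound
    proof eventually_elim
      case (elim \<omega>)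
      have "(norm (y T \<omega>))\<^sup>2 \<le> T * X \<omega>" using elim T_pos by auto
      then show ?case by (subst (1 2) real_norm_def) simp
    qed
  qed (use yT in simp)
qed

text \<open>The part of the argument that is free of signatures. Integrability is assumed for the
  measurable version \<open>P'\<close>, whereas the conclusions concern \<open>P\<close>. Condition
  \<open>Q2P2\<close> stands alone because it is obtained differently for \<open>N = 0\<close> and
  for larger \<open>N\<close>. Integrability is concluded along with the formula because the Bochner
  integral of a nonintegrable function is 0 by convention.\<close>

lemma quadratic_objective:
  fixes x y :: "real \<Rightarrow> 'w \<Rightarrow> real ^ 'm::finite" and P P' :: "real \<Rightarrow> 'w \<Rightarrow> real ^ 'n::finite"
    and K :: "real ^ 'm ^ 'n" and \<Lambda> \<Sigma>' :: "real ^ 'n ^ 'n" and \<phi> \<eta> \<gamma> :: real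
  assumes x: "(\<lambda>(\<omega>, t). x t \<omega>) \<in> borel_measurable (M \<Otimes>\<^sub>M I)"
    and P': "(\<lambda>(\<omega>, t). P' t \<omega>) \<in> borel_measurable (M \<Otimes>\<^sub>M I)"
    and eq: "AE \<omega> in M. \<forall>t\<in>{0..T}. P t \<omega> = P' t \<omega>"
    and y: "y = (\<lambda>t \<omega>. LINT u:{0..t}|lborel. x u \<omega>)"
    and x2: "integrable (M \<Otimes>\<^sub>M I) (\<lambda>(\<omega>, t). (norm (x t \<omega>))\<^sup>2)"
    and P2y2: "integrable (M \<Otimes>\<^sub>M I) (\<lambda>(\<omega>, t). (norm (P' t \<omega>))\<^sup>2 * (norm (y t \<omega>))\<^sup>2)"
    and Q2P2: "integrable (M \<Otimes>\<^sub>M I) (\<lambda>(\<omega>, t). \<eta> * (Q0 \<bullet> P' t \<omega>)\<^sup>2)"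
    and nonneg: "\<phi> \<ge> 0" "\<eta> \<ge> 0"
    and \<Lambda>: "transpose \<Lambda> = \<Lambda>" and \<Sigma>': "transpose \<Sigma>' = \<Sigma>'"
  defines "pay \<equiv> \<lambda>B. payoff T \<Lambda> \<Sigma>' \<phi> \<eta> \<gamma> Q0 P (\<lambda>t \<omega>. K *v x t \<omega>) (\<lambda>t \<omega>. B *v x t \<omega>)"
    and "A \<equiv> quadratic_rv T \<Lambda> \<Sigma>' \<phi> \<eta> \<gamma> P x y"
    and "b \<equiv> linear_rv T \<Sigma>' \<phi> \<eta> \<gamma> Q0 K P x y"
    and "c \<equiv> constant_rv T \<Sigma>' \<phi> \<eta> \<gamma> Q0 K P x"
  shows "integrable M A" "integrable M b" "integrable M c" "integrable M (pay B)"
    and "integral\<^sup>L M (pay B) = - (colvec B \<bullet> (integral\<^sup>L M A *v colvec B))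
      + integral\<^sup>L M b \<bullet> colvec B + integral\<^sup>L M c"
    and "transpose (integral\<^sup>L M A) = integral\<^sup>L M A"
proof -
  note bounds = running_integral_bounds[OF x x2 y]
  obtain k where k: "k \<ge> 0" "\<And>u. norm (K *v u) \<le> k * norm u"
    using matrix_vector_norm_bound by blast
  have x2': "integrable (M \<Otimes>\<^sub>M I) (\<lambda>z. (norm (x (snd z) (fst z)))\<^sup>2)"
    using x2 by (simp add: case_prod_unfold)
  have y2': "integrable (M \<Otimes>\<^sub>M I) (\<lambda>z. (norm (y (snd z) (fst z)))\<^sup>2)"
    using bounds(2) by (simp add: case_prod_unfold)
  have P2y2': "integrable (M \<Otimes>\<^sub>M I) (\<lambda>z. (norm (P' (snd z) (fst z)))\<^sup>2 * (norm (y (snd z) (fst z)))\<^sup>2)"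
    using P2y2 by (simp add: case_prod_unfold)
  have Q2P2': "integrable (M \<Otimes>\<^sub>M I) (\<lambda>z. \<eta> * (Q0 \<bullet> P' (snd z) (fst z))\<^sup>2)"
    using Q2P2 by (simp add: case_prod_unfold)
  interpret prod: finite_measure "M \<Otimes>\<^sub>M I"
    by (rule finite_measure_pair_measure) unfold_locales
  have one: "integrable (M \<Otimes>\<^sub>M I) (\<lambda>z. a)" for a :: real by simp
  have [measurable]: "(\<lambda>z. x (snd z) (fst z)) \<in> borel_measurable (M \<Otimes>\<^sub>M I)"
    using x by (simp add: case_prod_unfold)
  have [measurable]: "(\<lambda>z. P' (snd z) (fst z)) \<in> borel_measurable (M \<Otimes>\<^sub>M I)"
    using P' by (simp add: case_prod_unfold)
  have [measurable]: "(\<lambda>z. y (snd z) (fst z)) \<in> borel_measurable (M \<Otimes>\<^sub>M I)"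
    using borel_measurable_running_integral[OF x] by (simp add: y case_prod_unfold)
  note [measurable] = bounds(4)

  have "integrable (M \<Otimes>\<^sub>M I) (\<lambda>(\<omega>, t). kron_mat (outer (x t \<omega>)) \<Lambda>)"
    unfolding case_prod_unfold
    by (rule Bochner_Integration.integrable_bound[OF integrable_mult_left[OF x2', of "norm \<Lambda>"]])
       (auto simp: norm_kron_mat norm_outer)
  \<comment> \<open>This fact and \<open>quad2\<close>, \<open>lin\<close>, \<open>const\<close>
    below still carry a premise: almost sure equality of the integrand with its version in
    \<open>P'\<close>. These premises are discharged together after the last estimate.\<close>
  note quad1 = integrable_time_integral[OF this, of "\<lambda>t \<omega>. kron_mat (outer (x t \<omega>)) \<Lambda>"]
  have "integrable (M \<Otimes>\<^sub>M I) (\<lambda>(\<omega>, t). kron_mat (outer (y t \<omega>)) (\<phi> *\<^sub>R \<Sigma>' + \<eta> *\<^sub>R outer (P' t \<omega>)))"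
    unfolding case_prod_unfold
  proof (rule Bochner_Integration.integrable_bound[OF Bochner_Integration.integrable_add[OF
        integrable_mult_left[OF y2', of "\<phi> * norm \<Sigma>'"] integrable_mult_right[OF P2y2', of \<eta>]]])
    have bound: "norm (kron_mat (outer u) (\<phi> *\<^sub>R \<Sigma>' + \<eta> *\<^sub>R outer w))
        \<le> (norm u)\<^sup>2 * (\<phi> * norm \<Sigma>') + \<eta> * ((norm w)\<^sup>2 * (norm u)\<^sup>2)"
      for u :: "real ^ 'm" and w :: "real ^ 'n"
    proof -
      have "norm (\<phi> *\<^sub>R \<Sigma>' + \<eta> *\<^sub>R outer w) \<le> \<phi> * norm \<Sigma>' + \<eta> * (norm w)\<^sup>2"
        using norm_triangle_ineq[of "\<phi> *\<^sub>R \<Sigma>'" "\<eta> *\<^sub>R outer w"] nonneg by (simp add: norm_outer)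
      then have "(norm u)\<^sup>2 * norm (\<phi> *\<^sub>R \<Sigma>' + \<eta> *\<^sub>R outer w) \<le> (norm u)\<^sup>2 * (\<phi> * norm \<Sigma>' + \<eta> * (norm w)\<^sup>2)"
        by (rule mult_left_mono) simp
      then show ?thesis by (simp add: norm_kron_mat norm_outer algebra_simps)
    qed
    show "AE z in M \<Otimes>\<^sub>M I. norm (kron_mat (outer (y (snd z) (fst z))) (\<phi> *\<^sub>R \<Sigma>' + \<eta> *\<^sub>R outer (P' (snd z) (fst z))))
        \<le> norm ((norm (y (snd z) (fst z)))\<^sup>2 * (\<phi> * norm \<Sigma>')
          + \<eta> * ((norm (P' (snd z) (fst z)))\<^sup>2 * (norm (y (snd z) (fst z)))\<^sup>2))"
      by (intro AE_I2, subst real_norm_def, rule order_trans[OF bound abs_ge_self])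
  qed measurable
  note quad2 = integrable_time_integral[OF this,
      of "\<lambda>t \<omega>. kron_mat (outer (y t \<omega>)) (\<phi> *\<^sub>R \<Sigma>' + \<eta> *\<^sub>R outer (P t \<omega>))"]
  have "integrable M (\<lambda>\<omega>. kron_mat (outer (y T \<omega>)) (mat 1 :: real ^ 'n ^ 'n))"
    by (rule Bochner_Integration.integrable_bound[OF integrable_mult_left[OF bounds(3),
            of "norm (mat 1 :: real ^ 'n ^ 'n)"]])
       (auto simp: norm_kron_mat norm_outer)
  note quad3 = integrable_scaleR_right[OF this, of \<gamma>]
  define s where "s = norm (\<Sigma>' *v Q0)"
  have "integrable (M \<Otimes>\<^sub>M I) (\<lambda>(\<omega>, t). kron_vec (y t \<omega>)
      (K *v x t \<omega> - (2 * \<phi>) *\<^sub>R (\<Sigma>' *v Q0) - (2 * \<eta>) *\<^sub>R (outer (P' t \<omega>) *v Q0)))"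
    unfolding case_prod_unfold
  proof (rule Bochner_Integration.integrable_bound)
    \<comment> \<open>The products are split by 2ab \<le> a^2 + b^2, for the price term with a =
      |p||w| and b = \<eta> |Q0 \<bullet> p|. Keeping \<eta> inside b makes the last summand a
      multiple of the integrand of \<open>Q2P2\<close>, which contains \<eta> itself. The bound 1 +
      |w|^2 replaces |w|.\<close>
    let ?g = "\<lambda>z. k * ((norm (y (snd z) (fst z)))\<^sup>2 + (norm (x (snd z) (fst z)))\<^sup>2)
      + 2 * \<phi> * s * (1 + (norm (y (snd z) (fst z)))\<^sup>2)
      + (norm (P' (snd z) (fst z)))\<^sup>2 * (norm (y (snd z) (fst z)))\<^sup>2
      + \<eta> * (\<eta> * (Q0 \<bullet> P' (snd z) (fst z))\<^sup>2)"
    show "integrable (M \<Otimes>\<^sub>M I) ?g"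
      by (intro Bochner_Integration.integrable_add integrable_mult_right x2' y2' P2y2' Q2P2' one)
    have bound: "norm (kron_vec w (K *v u - (2 * \<phi>) *\<^sub>R (\<Sigma>' *v Q0) - (2 * \<eta>) *\<^sub>R (outer p *v Q0)))
        \<le> k * ((norm w)\<^sup>2 + (norm u)\<^sup>2) + 2 * \<phi> * s * (1 + (norm w)\<^sup>2) + (norm p)\<^sup>2 * (norm w)\<^sup>2
          + \<eta> * (\<eta> * (Q0 \<bullet> p)\<^sup>2)"
      for u w :: "real ^ 'm" and p :: "real ^ 'n"
    proof -
      have "norm (K *v u - (2 * \<phi>) *\<^sub>R (\<Sigma>' *v Q0) - (2 * \<eta>) *\<^sub>R (outer p *v Q0))
          \<le> norm (K *v u) + norm ((2 * \<phi>) *\<^sub>R (\<Sigma>' *v Q0)) + norm ((2 * \<eta>) *\<^sub>R (outer p *v Q0))"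
        by (rule order_trans[OF norm_triangle_ineq4 add_right_mono[OF norm_triangle_ineq4]])
      also have "\<dots> \<le> k * norm u + 2 * \<phi> * s + 2 * \<eta> * (\<bar>Q0 \<bullet> p\<bar> * norm p)"
        using k(2)[of u] nonneg by (simp add: s_def outer_mult_vec inner_commute abs_mult)
      finally have "norm w * norm (K *v u - (2 * \<phi>) *\<^sub>R (\<Sigma>' *v Q0) - (2 * \<eta>) *\<^sub>R (outer p *v Q0))
          \<le> norm w * (k * norm u + 2 * \<phi> * s + 2 * \<eta> * (\<bar>Q0 \<bullet> p\<bar> * norm p))"
        by (rule mult_left_mono) simp
      also have "\<dots> = k * (norm w * norm u) + 2 * \<phi> * s * norm w
          + 2 * (norm p * norm w) * (\<eta> * \<bar>Q0 \<bullet> p\<bar>)"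
        by (simp add: algebra_simps)
      also have "\<dots> \<le> k * ((norm w)\<^sup>2 + (norm u)\<^sup>2) + 2 * \<phi> * s * (1 + (norm w)\<^sup>2)
          + ((norm p * norm w)\<^sup>2 + (\<eta> * \<bar>Q0 \<bullet> p\<bar>)\<^sup>2)"
      proof (intro add_mono mult_left_mono)
        have "2 * norm w * norm u \<le> (norm w)\<^sup>2 + (norm u)\<^sup>2" by (rule sum_squares_bound)
        moreover have "0 \<le> norm w * norm u" by simp
        ultimately show "norm w * norm u \<le> (norm w)\<^sup>2 + (norm u)\<^sup>2" by linarith
        have "2 * norm w * 1 \<le> (norm w)\<^sup>2 + 1\<^sup>2" by (rule sum_squares_bound)
        then have "2 * norm w \<le> (norm w)\<^sup>2 + 1" by simp
        then show "norm w \<le> 1 + (norm w)\<^sup>2" using norm_ge_zero[of w] by linarith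
        show "2 * (norm p * norm w) * (\<eta> * \<bar>Q0 \<bullet> p\<bar>) \<le> (norm p * norm w)\<^sup>2 + (\<eta> * \<bar>Q0 \<bullet> p\<bar>)\<^sup>2"
          by (rule sum_squares_bound)
      qed (use k nonneg in \<open>auto simp: s_def\<close>)
      also have "\<dots> = k * ((norm w)\<^sup>2 + (norm u)\<^sup>2) + 2 * \<phi> * s * (1 + (norm w)\<^sup>2)
          + (norm p)\<^sup>2 * (norm w)\<^sup>2 + \<eta> * (\<eta> * (Q0 \<bullet> p)\<^sup>2)"
        by (simp add: power_mult_distrib) (simp add: power2_eq_square)
      finally show ?thesis by (simp only: norm_kron_vec)
    qed
    show "AE z in M \<Otimes>\<^sub>M I. norm (kron_vec (y (snd z) (fst z)) (K *v x (snd z) (fst z)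
        - (2 * \<phi>) *\<^sub>R (\<Sigma>' *v Q0) - (2 * \<eta>) *\<^sub>R (outer (P' (snd z) (fst z)) *v Q0))) \<le> norm (?g z)"
      by (intro AE_I2, subst real_norm_def, rule order_trans[OF bound abs_ge_self])
  qed (unfold outer_mult_vec, measurable)
  note lin = integrable_time_integral[OF this, of "\<lambda>t \<omega>. kron_vec (y t \<omega>)
      (K *v x t \<omega> - (2 * \<phi>) *\<^sub>R (\<Sigma>' *v Q0) - (2 * \<eta>) *\<^sub>R (outer (P t \<omega>) *v Q0))"]
  have yint: "integrable M (\<lambda>\<omega>. y T \<omega>)"
    by (rule norm_integral_power2_le) (use bounds(3,4) in auto)
  have "integrable M (\<lambda>\<omega>. kron_vec (y T \<omega>) Q0)"
    by (rule Bochner_Integration.integrable_bound[OF integrable_mult_left[OF integrable_norm[OF yint], of "norm Q0"]])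
       (auto simp: norm_kron_vec)
  note lin2 = integrable_scaleR_right[OF this, of "2 * \<gamma>"]
  have Kx: "integrable (M \<Otimes>\<^sub>M I) (\<lambda>z. Q0 \<bullet> (K *v x (snd z) (fst z)))"
  proof -
    have "integrable (M \<Otimes>\<^sub>M I) (\<lambda>z. x (snd z) (fst z))"
      by (rule prod.norm_integral_power2_le) (use x2' in auto)
    from integrable_bounded_linear[OF matrix_vector_mul_bounded_linear this]
    show ?thesis by (rule integrable_inner_right)
  qed
  have "integrable (M \<Otimes>\<^sub>M I) (\<lambda>(\<omega>, t). Q0 \<bullet> (K *v x t \<omega>) - \<phi> * (Q0 \<bullet> (\<Sigma>' *v Q0)) - \<eta> * (Q0 \<bullet> P' t \<omega>)\<^sup>2)"
    unfolding case_prod_unfold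
    by (intro Bochner_Integration.integrable_diff Kx Q2P2' one)
  note const = integrable_time_integral[OF this,
      of "\<lambda>t \<omega>. Q0 \<bullet> (K *v x t \<omega>) - \<phi> * (Q0 \<bullet> (\<Sigma>' *v Q0)) - \<eta> * (Q0 \<bullet> P t \<omega>)\<^sup>2"]

  have "AE \<omega> in M. \<forall>t\<in>{0..T}. kron_mat (outer (x t \<omega>)) \<Lambda> = kron_mat (outer (x t \<omega>)) \<Lambda>"
    by simp
  note quad1 = quad1[OF this]
  have "AE \<omega> in M. \<forall>t\<in>{0..T}. kron_mat (outer (y t \<omega>)) (\<phi> *\<^sub>R \<Sigma>' + \<eta> *\<^sub>R outer (P t \<omega>))
        = kron_mat (outer (y t \<omega>)) (\<phi> *\<^sub>R \<Sigma>' + \<eta> *\<^sub>R outer (P' t \<omega>))"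
    using eq by eventually_elim simp
  note quad2 = quad2[OF this]
  have "AE \<omega> in M. \<forall>t\<in>{0..T}. kron_vec (y t \<omega>)
        (K *v x t \<omega> - (2 * \<phi>) *\<^sub>R (\<Sigma>' *v Q0) - (2 * \<eta>) *\<^sub>R (outer (P t \<omega>) *v Q0))
      = kron_vec (y t \<omega>)
        (K *v x t \<omega> - (2 * \<phi>) *\<^sub>R (\<Sigma>' *v Q0) - (2 * \<eta>) *\<^sub>R (outer (P' t \<omega>) *v Q0))"
    using eq by eventually_elim simp
  note lin = lin[OF this]
  have "AE \<omega> in M. \<forall>t\<in>{0..T}. Q0 \<bullet> (K *v x t \<omega>) - \<phi> * (Q0 \<bullet> (\<Sigma>' *v Q0)) - \<eta> * (Q0 \<bullet> P t \<omega>)\<^sup>2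
      = Q0 \<bullet> (K *v x t \<omega>) - \<phi> * (Q0 \<bullet> (\<Sigma>' *v Q0)) - \<eta> * (Q0 \<bullet> P' t \<omega>)\<^sup>2"
    using eq by eventually_elim simp
  note const = const[OF this]

  show A: "integrable M A"
    unfolding A_def quadratic_rv_def[abs_def] by (intro Bochner_Integration.integrable_add quad1 quad2 quad3)
  show b: "integrable M b"
    unfolding b_def linear_rv_def[abs_def] by (intro Bochner_Integration.integrable_diff lin lin2)
  show c: "integrable M c"
    unfolding c_def constant_rv_def[abs_def] by (intro Bochner_Integration.integrable_diff const) simp
  let ?q = "\<lambda>C. colvec B \<bullet> (C *v colvec B)"
  have q: "bounded_linear ?q" by (rule bounded_linear_quadratic_form)
  have int: "integrable M (\<lambda>\<omega>. - ?q (A \<omega>) + b \<omega> \<bullet> colvec B + c \<omega>)"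
    using integrable_bounded_linear[OF q A] b c by simp
  \<comment> \<open>The five almost sure facts come in the order of the remaining premises of
    \<open>payoff_linear_strategy\<close>. Measurability of the payoff is not shown directly; it
    follows from this identity by completeness.\<close>
  have pay: "AE \<omega> in M. - ?q (A \<omega>) + b \<omega> \<bullet> colvec B + c \<omega> = pay B \<omega>"
    using bounds(1) quad1(1) quad2(1) lin(1) const(1)
  proof eventually_elim
    case (elim \<omega>)
    show ?case unfolding A_def b_def c_def pay_def
      by (rule payoff_linear_strategy[where x = x and y = y and P = P and \<omega> = \<omega>, OF \<Sigma>' _ elim, symmetric]) (simp only: y)
  qed
  show payint: "integrable M (pay B)" by (rule integrable_cong_AE_complete[OF int pay])
  have "integral\<^sup>L M (pay B) = (\<integral>\<omega>. - ?q (A \<omega>) + b \<omega> \<bullet> colvec B + c \<omega> \<partial>M)"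
  proof (rule integral_cong_AE[OF borel_measurable_integrable[OF payint] borel_measurable_integrable[OF int]])
    show "AE \<omega> in M. pay B \<omega> = - ?q (A \<omega>) + b \<omega> \<bullet> colvec B + c \<omega>"
      using pay by eventually_elim (rule sym)
  qed
  also have "\<dots> = - ?q (integral\<^sup>L M A) + integral\<^sup>L M b \<bullet> colvec B + integral\<^sup>L M c"
    using integrable_bounded_linear[OF q A] b c integral_bounded_linear[OF q A] by simp
  finally show "integral\<^sup>L M (pay B) = - ?q (integral\<^sup>L M A) + integral\<^sup>L M b \<bullet> colvec B + integral\<^sup>L M c" .
  \<comment> \<open>Symmetry is obtained path by path, where the time integrals converge and the
    transpose may be moved under them, and only then in expectation.\<close>
  have "AE \<omega> in M. transpose (A \<omega>) = A \<omega>"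
    using quad1(1) quad2(1)
  proof eventually_elim
    case (elim \<omega>)
    note tr = integral_bounded_linear[OF bounded_linear_transpose, symmetric]
    have tadd: "transpose (C + D) = transpose C + transpose D"
      and tscale: "transpose (r *\<^sub>R C) = r *\<^sub>R transpose C" for C D :: "real ^ 'a::finite ^ 'a" and r
      by (simp_all add: linear_add[OF bounded_linear.linear[OF bounded_linear_transpose]]
          linear_scale[OF bounded_linear.linear[OF bounded_linear_transpose]])
    have t2: "transpose (\<phi> *\<^sub>R \<Sigma>' + \<eta> *\<^sub>R outer w) = \<phi> *\<^sub>R \<Sigma>' + \<eta> *\<^sub>R outer w" for w
      by (simp add: tadd tscale \<Sigma>' transpose_outer)
    show ?case
      unfolding A_def quadratic_rv_def set_integral_eq_I tadd tscale tr[OF elim(1)] tr[OF elim(2)]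
        transpose_kron_mat_outer[OF \<Lambda>] transpose_kron_mat_outer[OF t2]
        transpose_kron_mat_outer[OF transpose_mat] ..
  qed
  then have "(\<integral>\<omega>. transpose (A \<omega>) \<partial>M) = integral\<^sup>L M A"
    by (rule integral_cong_AE[OF borel_measurable_integrable[OF integrable_bounded_linear[OF
            bounded_linear_transpose A]] borel_measurable_integrable[OF A]])
  then show "transpose (integral\<^sup>L M A) = integral\<^sup>L M A"
    by (simp add: integral_bounded_linear[OF bounded_linear_transpose A])
qed

end

section \<open>What the signature coordinates and the progressive strategies provide\<close>

text \<open>Truncation puts \<open>f\<close> into the space spanned by the basis, so the definite
  description in \<open>tensor_coords\<close> denotes its coordinate vector.\<close>

lemma tensor_coords_expand:
  assumes e: "is_tensor_basis N e" and w: "length w \<le> N"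
  shows "(\<Sum>j\<in>UNIV. tensor_coords e (truncate N f) $ j * e j w) = f w"
proof -
  have "truncate N f \<in> truncated_tensors N"
    by (simp add: truncate_def truncated_tensors_def)
  then have "\<exists>!c :: real ^ 'a. truncate N f = (\<lambda>w. \<Sum>j\<in>UNIV. c $ j * e j w)"
    using e by (simp add: is_tensor_basis_def)
  from theI'[OF this] have "truncate N f = (\<lambda>w. \<Sum>j\<in>UNIV. tensor_coords e (truncate N f) $ j * e j w)"
    by (simp only: tensor_coords_def)
  from fun_cong[OF this, of w] show ?thesis
    using w by (simp add: truncate_def)
qed

text \<open>A fixed linear functional is constantly 1 on \<open>x\<close>. Integrated over [0, t] it
  takes the value t on y_t, which bounds |y_t| from below.\<close>

lemma signature_coords_level_0:
  assumes e: "is_tensor_basis N e" and S: "signature_of T p N X S" and t: "0 \<le> t" "t \<le> T"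
  shows "tensor_coords e (truncate N (S 0 t)) \<bullet> (\<chi> j. e j []) = 1"
proof -
  have "multiplicative T N S"
    using S by (simp add: signature_of_def finite_variation_functional_def)
  then have "S 0 t [] = 1"
    unfolding multiplicative_def using t by blast
  then show ?thesis
    using tensor_coords_expand[OF e, of "[]" "S 0 t"] by (simp add: inner_vec_def)
qed

text \<open>One-letter words have length at most \<open>N\<close> and at most the floor of
  \<open>p\<close>, so the signature agrees there with the lift. Hence a fixed matrix recovers the
  increments of the path from \<open>x\<close>.\<close>

lemma signature_coords_level_1:
  assumes e: "is_tensor_basis N e" and S: "signature_of T p N X S" and t: "0 \<le> t" "t \<le> T"
    and N: "N \<noteq> 0" and p: "p \<ge> 1"
  shows "((\<chi> i j. e j [i]) *v tensor_coords e (truncate N (S 0 t))) $ i = X 0 t [i]"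
proof -
  have "nat \<lfloor>p\<rfloor> \<ge> 1" using p by (simp add: le_nat_iff)
  then have "S 0 t [i] = X 0 t [i]"
    using S t N by (simp add: signature_of_def)
  then show ?thesis
    using tensor_coords_expand[OF e, of "[i]" "S 0 t"] N
    by (simp add: matrix_vector_mult_def mult.commute)
qed

text \<open>The instance \<open>t = T\<close> of progressive measurability is pulled back along the
  swap of outcome and time; \<open>F T\<close> is coarser than \<open>M\<close>, and Lebesgue and
  Borel time carry the same measurable sets.\<close>

lemma progressively_measurable_pair:
  assumes X: "progressively_measurable T F X" and F: "subalgebra M (F T)" and T: "T > 0"
  shows "(\<lambda>(\<omega>, t). X t \<omega>) \<in> borel_measurable (M \<Otimes>\<^sub>M time_space T)"
proof -
  have X: "(\<lambda>(s, \<omega>). X s \<omega>) \<in> borel_measurable (restrict_space borel {0..T} \<Otimes>\<^sub>M F T)"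
    using X T by (simp add: progressively_measurable_def)
  have fst: "fst \<in> M \<Otimes>\<^sub>M time_space T \<rightarrow>\<^sub>M F T"
    by (rule measurable_compose[OF measurable_fst, of "\<lambda>\<omega>. \<omega>", simplified], rule measurableI)
       (use F in \<open>auto simp: subalgebra_def dest: sets.sets_into_space\<close>)
  have "sets (time_space T) = sets (restrict_space borel {0..T})"
    by (rule sets_restrict_space_cong) simp
  then have snd: "snd \<in> M \<Otimes>\<^sub>M time_space T \<rightarrow>\<^sub>M restrict_space borel {0..T}"
    using measurable_snd[of M "time_space T"] by (simp cong: measurable_cong_sets)
  show ?thesis
    using measurable_compose[OF measurable_Pair[OF snd fst] X] by (simp add: case_prod_unfold)
qed

section \<open>Square integrability of the price\<close>

context complete_time_prob
begin

text \<open>The exceptional outcomes form a null set, measurable by completeness, and the cylinder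
  over it is null in the product.\<close>

lemma AE_pair_of_AE_fst:
  assumes "AE \<omega> in M. \<forall>t\<in>{0..T}. Q \<omega> t"
  shows "AE z in M \<Otimes>\<^sub>M I. Q (fst z) (snd z)"
proof -
  define A where "A = {\<omega>\<in>space M. \<not> (\<forall>t\<in>{0..T}. Q \<omega> t)}"
  have A: "A \<in> null_sets M"
    unfolding A_def using assms by (simp only: AE_iff_null_sets)
  have "A \<times> space I \<in> null_sets (M \<Otimes>\<^sub>M I)"
    using A sets.top[of I] by (simp add: null_sets_def I.emeasure_pair_measure_Times del: sets.top)
  then show ?thesis
    by (rule AE_I') (auto simp: A_def space_pair_measure space_I)
qed

lemma integrable_pair_fst:
  assumes g: "integrable M (g :: 'w \<Rightarrow> real)"
  shows "integrable (M \<Otimes>\<^sub>M I) (\<lambda>z. g (fst z))"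
  by (rule MI.Fubini_integrable) (use g in auto)

text \<open>Level 0 of the signature gives \<open>t \<le> C \<bar>y\<^sub>t\<bar>\<close> and level 1 gives \<open>\<bar>P\<^sub>t - P\<^sub>0\<bar> \<le> C \<bar>x\<^sub>t\<bar>\<close>, so
  \<open>t\<^sup>2 \<bar>P\<^sub>0\<bar>\<^sup>2\<close> is integrable over time and probability. Hence so is \<open>\<bar>P\<^sub>0\<bar>\<^sup>2\<close>, and then \<open>\<bar>P\<^sub>t\<bar>\<^sup>2\<close>.\<close>

lemma integrable_price_power2:
  fixes x y :: "real \<Rightarrow> 'w \<Rightarrow> 'b::{banach, second_countable_topology}"
    and P :: "real \<Rightarrow> 'w \<Rightarrow> 'c::{banach, second_countable_topology}"
  assumes P: "(\<lambda>(\<omega>, t). P t \<omega>) \<in> borel_measurable (M \<Otimes>\<^sub>M I)"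
    and x2: "integrable (M \<Otimes>\<^sub>M I) (\<lambda>(\<omega>, t). (norm (x t \<omega>))\<^sup>2)"
    and P2y2: "integrable (M \<Otimes>\<^sub>M I) (\<lambda>(\<omega>, t). (norm (P t \<omega>))\<^sup>2 * (norm (y t \<omega>))\<^sup>2)"
    and y_lower: "AE \<omega> in M. \<forall>t\<in>{0..T}. t \<le> a * norm (y t \<omega>)"
    and increment: "AE \<omega> in M. \<forall>t\<in>{0..T}. norm (P t \<omega> - P 0 \<omega>) \<le> k * norm (x t \<omega>)"
  shows "integrable (M \<Otimes>\<^sub>M I) (\<lambda>(\<omega>, t). (norm (P t \<omega>))\<^sup>2)"
proof -
  have x2': "integrable (M \<Otimes>\<^sub>M I) (\<lambda>z. (norm (x (snd z) (fst z)))\<^sup>2)"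
    using x2 by (simp add: case_prod_unfold)
  have P2y2': "integrable (M \<Otimes>\<^sub>M I) (\<lambda>z. (norm (P (snd z) (fst z)))\<^sup>2 * (norm (y (snd z) (fst z)))\<^sup>2)"
    using P2y2 by (simp add: case_prod_unfold)
  have Pm: "(\<lambda>z. P (snd z) (fst z)) \<in> borel_measurable (M \<Otimes>\<^sub>M I)"
    using P by (simp add: case_prod_unfold)
  have "0 \<in> space I" using T_pos by (simp add: space_I)
  from measurable_compose[OF measurable_Pair2'[OF this] P]
  have P0 [measurable]: "(\<lambda>\<omega>. P 0 \<omega>) \<in> borel_measurable M" by simp
  have sq: "(norm u)\<^sup>2 \<le> 2 * (norm v)\<^sup>2 + 2 * (k * r)\<^sup>2" if "norm (u - v) \<le> k * r"
    for u v :: 'c and r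
  proof -
    have "norm u \<le> norm v + k * r"
      using that norm_triangle_ineq2[of u v] by linarith
    then have "(norm u)\<^sup>2 \<le> (norm v + k * r)\<^sup>2" by (rule power_mono) simp
    also have "\<dots> \<le> 2 * (norm v)\<^sup>2 + 2 * (k * r)\<^sup>2"
      using sum_squares_bound[of "norm v" "k * r"] by (simp add: power2_sum)
    finally show ?thesis .
  qed
  \<comment> \<open>Only the second half of the interval is used, since t \<le> a |y_t| degenerates
    at 0. There (T/2)^2 \<le> a^2 |y_t|^2, whence 4/T^2; the factors 2 come from (r + s)^2 \<le> 2
    r^2 + 2 s^2 applied to P_0 = P_t - (P_t - P_0).\<close>
  define R where "R \<omega> t = 2 * (a\<^sup>2 * ((norm (P t \<omega>))\<^sup>2 * (norm (y t \<omega>))\<^sup>2)) * (4 / T\<^sup>2)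
      + 2 * (k\<^sup>2 * (norm (x t \<omega>))\<^sup>2)" for \<omega> t
  have late: "AE \<omega> in M. \<forall>t\<in>{0..T}. indicator {T/2..T} t * (norm (P 0 \<omega>))\<^sup>2 \<le> R \<omega> t"
    using y_lower increment
  proof eventually_elim
    case (elim \<omega>)
    show ?case
    proof
      fix t assume t: "t \<in> {0..T}"
      show "indicator {T/2..T} t * (norm (P 0 \<omega>))\<^sup>2 \<le> R \<omega> t"
      proof (cases "t \<in> {T/2..T}")
        case True
        have "(T / 2)\<^sup>2 \<le> (a * norm (y t \<omega>))\<^sup>2"
          using elim(1)[rule_format, OF t] True T_pos by (intro power_mono) auto
        then have "1 \<le> a\<^sup>2 * (norm (y t \<omega>))\<^sup>2 * (4 / T\<^sup>2)"
          using T_pos by (simp add: power_mult_distrib power_divide field_simps)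
        then have "(norm (P t \<omega>))\<^sup>2 * 1 \<le> (norm (P t \<omega>))\<^sup>2 * (a\<^sup>2 * (norm (y t \<omega>))\<^sup>2 * (4 / T\<^sup>2))"
          by (intro mult_left_mono) auto
        moreover have "(norm (P 0 \<omega>))\<^sup>2 \<le> 2 * (norm (P t \<omega>))\<^sup>2 + 2 * (k * norm (x t \<omega>))\<^sup>2"
          by (rule sq) (use elim(2)[rule_format, OF t] in \<open>simp add: norm_minus_commute\<close>)
        ultimately show ?thesis using True by (simp add: R_def power_mult_distrib mult_ac)
      qed (simp add: R_def)
    qed
  qed
  have "integrable (M \<Otimes>\<^sub>M I) (\<lambda>z. R (fst z) (snd z))"
    unfolding R_def
    by (intro Bochner_Integration.integrable_add integrable_mult_right integrable_mult_left x2' P2y2')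
  then have int: "integrable (M \<Otimes>\<^sub>M I) (\<lambda>z. indicator {T/2..T} (snd z) * (norm (P 0 (fst z)))\<^sup>2)"
  proof (rule Bochner_Integration.integrable_bound)
    have [measurable]: "{T/2..T} \<in> sets I" using T_pos by (auto simp: sets_restrict_space_iff)
    show "(\<lambda>z. indicator {T/2..T} (snd z) * (norm (P 0 (fst z)))\<^sup>2) \<in> borel_measurable (M \<Otimes>\<^sub>M I)"
      by measurable
    show "AE z in M \<Otimes>\<^sub>M I. norm (indicator {T/2..T} (snd z) * (norm (P 0 (fst z)))\<^sup>2)
        \<le> norm (R (fst z) (snd z))"
      using AE_pair_of_AE_fst[OF late]
      by eventually_elim (simp add: abs_mult)
  qed
  \<comment> \<open>As \<open>P 0\<close> does not depend on time, integrating time out leaves T/2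
    times |P_0|^2; the factor 2/T below undoes this.\<close>
  have "(\<integral>t. indicator {T/2..T} t \<partial>I) = T / 2"
    using T_pos by (subst integral_indicator_I) auto
  then have "integrable M (\<lambda>\<omega>. T / 2 * (norm (P 0 \<omega>))\<^sup>2)"
    using MI.integrable_fst'[OF int] by (simp only: integral_mult_left_zero fst_conv snd_conv)
  from integrable_mult_right[OF this, of "2 / T"]
  have "integrable M (\<lambda>\<omega>. (norm (P 0 \<omega>))\<^sup>2)" using T_pos by simp
  from integrable_pair_fst[OF this]
  have "integrable (M \<Otimes>\<^sub>M I) (\<lambda>z. 2 * (norm (P 0 (fst z)))\<^sup>2 + 2 * (k\<^sup>2 * (norm (x (snd z) (fst z)))\<^sup>2))"
    by (intro Bochner_Integration.integrable_add integrable_mult_right x2')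
  then have "integrable (M \<Otimes>\<^sub>M I) (\<lambda>z. (norm (P (snd z) (fst z)))\<^sup>2)"
  proof (rule Bochner_Integration.integrable_bound)
    have "AE \<omega> in M. \<forall>t\<in>{0..T}. (norm (P t \<omega>))\<^sup>2 \<le> 2 * (norm (P 0 \<omega>))\<^sup>2 + 2 * (k\<^sup>2 * (norm (x t \<omega>))\<^sup>2)"
      using increment
    proof eventually_elim
      case (elim \<omega>)
      then show ?case using sq by (metis power_mult_distrib)
    qed
    from AE_pair_of_AE_fst[OF this]
    show "AE z in M \<Otimes>\<^sub>M I. norm ((norm (P (snd z) (fst z)))\<^sup>2)
        \<le> norm (2 * (norm (P 0 (fst z)))\<^sup>2 + 2 * (k\<^sup>2 * (norm (x (snd z) (fst z)))\<^sup>2))"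
      by eventually_elim simp
  qed (use Pm in measurable)
  then show ?thesis by (simp add: case_prod_unfold)
qed

end

section \<open>The signature model satisfies the conditions of the quadratic expansion\<close>

theorem theorem2p9:
  fixes T p \<phi> \<eta> \<gamma> :: real
    and N :: nat
    and M :: "'w measure"
    and F :: "real \<Rightarrow> 'w measure"
    and Z :: "real \<Rightarrow> 'w \<Rightarrow> real ^ ('d::finite)"
    and ZZ SZ :: "'w \<Rightarrow> 'd functional"
    and \<pi>P :: "real ^ 'd \<Rightarrow> real ^ ('n::finite)"
    and e :: "('m::finite) \<Rightarrow> 'd tensor"
    and x y :: "real \<Rightarrow> 'w \<Rightarrow> real ^ 'm"
    and P :: "real \<Rightarrow> 'w \<Rightarrow> real ^ 'n"
    and K :: "real ^ 'm ^ 'n"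
    and Q0 :: "real ^ 'n"
    and \<Lambda> \<Sigma>' :: "real ^ 'n ^ 'n"
    and J :: "real ^ 'm ^ 'n \<Rightarrow> real"
  assumes T: "T > 0"
    and basis: "usual_conditions T M F"
    and Z_cont: "AE \<omega> in M. continuous_on {0..T} (\<lambda>t. Z t \<omega>)"
    and Z_adapted: "adapted T F Z"
    and \<pi>P: "linear \<pi>P"
    and P: "P = (\<lambda>t \<omega>. \<pi>P (Z t \<omega>))"
    and p: "p \<ge> 1"
    and lift_geometric: "AE \<omega> in M. geometric_rough_path T p (ZZ \<omega>)"
    and lift_level1: "AE \<omega> in M. \<forall>s t i. 0 \<le> s \<and> s \<le> t \<and> t \<le> T \<longrightarrow>
                        ZZ \<omega> s t [i] = Z t \<omega> $ i - Z s \<omega> $ i"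
    and lift_adapted: "\<forall>s t w. 0 \<le> s \<and> s \<le> t \<and> t \<le> T \<and> length w \<le> nat \<lfloor>p\<rfloor> \<longrightarrow>
                        (\<lambda>\<omega>. ZZ \<omega> s t w) \<in> borel_measurable (F t)"
    and signature: "AE \<omega> in M. signature_of T p N (ZZ \<omega>) (SZ \<omega>)"
    and e: "is_tensor_basis N e"
    and x: "x = (\<lambda>t \<omega>. tensor_coords e (truncate N (SZ \<omega> 0 t)))"
    and y: "y = (\<lambda>t \<omega>. LINT u:{0..t}|lborel. x u \<omega>)"
    and x_int: "finite_expected_time_integral T M (\<lambda>t \<omega>. (norm (x t \<omega>))\<^sup>2)"
    and Py_int: "finite_expected_time_integral T M (\<lambda>t \<omega>. (norm (P t \<omega>))\<^sup>2 * (norm (y t \<omega>))\<^sup>2)"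
    and P_int_N0: "N = 0 \<Longrightarrow> finite_expected_time_integral T M (\<lambda>t \<omega>. \<eta> * (Q0 \<bullet> P t \<omega>)\<^sup>2)"
    and admissible: "\<forall>B :: real ^ 'm ^ 'n. admissible T M F (\<lambda>t \<omega>. B *v x t \<omega>)"
    and \<Lambda>: "sym_pos_def \<Lambda>"
    and \<Sigma>': "sym_pos_semidef \<Sigma>'"
    and nonneg: "\<phi> \<ge> 0" "\<eta> \<ge> 0" "\<gamma> \<ge> 0"
    and J: "J = (\<lambda>B. integral\<^sup>L M
                  (payoff T \<Lambda> \<Sigma>' \<phi> \<eta> \<gamma> Q0 P (\<lambda>t \<omega>. K *v x t \<omega>) (\<lambda>t \<omega>. B *v x t \<omega>)))"
  shows "(\<forall>B. integrable M
                (payoff T \<Lambda> \<Sigma>' \<phi> \<eta> \<gamma> Q0 P (\<lambda>t \<omega>. K *v x t \<omega>) (\<lambda>t \<omega>. B *v x t \<omega>))) \<and>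
         integrable M (quadratic_rv T \<Lambda> \<Sigma>' \<phi> \<eta> \<gamma> P x y) \<and>
         integrable M (linear_rv T \<Sigma>' \<phi> \<eta> \<gamma> Q0 K P x y) \<and>
         integrable M (constant_rv T \<Sigma>' \<phi> \<eta> \<gamma> Q0 K P x) \<and>
         (\<exists>(A :: real ^ ('m \<times> 'n) ^ ('m \<times> 'n)) (b :: real ^ ('m \<times> 'n)) (c :: real).
            transpose A = A \<and>
            (\<forall>B. J B = colvec B \<bullet> (A *v colvec B) + b \<bullet> colvec B + c) \<and>
            A = - integral\<^sup>L M (quadratic_rv T \<Lambda> \<Sigma>' \<phi> \<eta> \<gamma> P x y) \<and>
            b = integral\<^sup>L M (linear_rv T \<Sigma>' \<phi> \<eta> \<gamma> Q0 K P x y) \<and>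
            c = integral\<^sup>L M (constant_rv T \<Sigma>' \<phi> \<eta> \<gamma> Q0 K P x))"
proof -
  interpret complete_time_prob M T
    using basis T by (auto simp: usual_conditions_def complete_time_prob_def complete_time_prob_axioms_def)
  have F: "subalgebra M (F t)" if "t \<in> {0..T}" for t
    using basis that by (simp add: usual_conditions_def)
  have x_meas: "(\<lambda>(\<omega>, t). x t \<omega>) \<in> borel_measurable (M \<Otimes>\<^sub>M I)"
  proof (rule borel_measurable_vecI)
    fix j :: 'm
    \<comment> \<open>Every row of this matrix is the j-th unit row, so every component of
      \<open>B x\<close> equals the j-th coordinate of \<open>x\<close>. This turns admissibility
      into joint measurability of \<open>x\<close>; the row index \<open>undefined\<close> below is
      an arbitrary one.\<close>
    define B :: "real ^ 'm ^ 'n" where "B = (\<chi> i k. if k = j then 1 else 0)"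
    have B: "(B *v u) $ i = u $ j" for u i
      by (simp add: B_def matrix_vector_mult_def if_distrib[of "\<lambda>r. r * _"] cong: if_cong)
    have "progressively_measurable T F (\<lambda>t \<omega>. B *v x t \<omega>)"
      using admissible by (simp add: admissible_def)
    from progressively_measurable_pair[OF this F T] T
    have "(\<lambda>z. B *v x (snd z) (fst z)) \<in> borel_measurable (M \<Otimes>\<^sub>M I)"
      by (simp add: case_prod_unfold)
    then have "(\<lambda>z. (B *v x (snd z) (fst z)) $ undefined) \<in> borel_measurable (M \<Otimes>\<^sub>M I)"
      by (rule borel_measurable_continuous_on[OF continuous_on_component, rotated])
         (rule continuous_on_id)
    then show "(\<lambda>z. (case z of (\<omega>, t) \<Rightarrow> x t \<omega>) $ j) \<in> borel_measurable (M \<Otimes>\<^sub>M I)"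
      by (simp only: B case_prod_unfold)
  qed
  have \<pi>P_cont: "continuous_on A \<pi>P" for A
    using \<pi>P by (simp add: linear_continuous_on linear_conv_bounded_linear)
  have P_meas: "P t \<in> borel_measurable M" if t: "t \<in> {0..T}" for t
  proof -
    have "Z t \<in> borel_measurable M"
      by (rule measurable_from_subalg[OF F[OF t]]) (use Z_adapted t in \<open>simp add: adapted_def\<close>)
    then show ?thesis unfolding P by (rule borel_measurable_continuous_on[OF \<pi>P_cont])
  qed
  have P_cont: "AE \<omega> in M. continuous_on {0..T} (\<lambda>t. P t \<omega>)"
    using Z_cont by eventually_elim (auto simp: P intro: continuous_on_compose2[OF \<pi>P_cont[of UNIV]])
  obtain P' where P': "(\<lambda>(\<omega>, t). P' t \<omega>) \<in> borel_measurable (M \<Otimes>\<^sub>M I)"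
    and eq: "AE \<omega> in M. \<forall>t\<in>{0..T}. P t \<omega> = P' t \<omega>"
    by (rule continuous_paths_modification[OF P_meas P_cont])
  have y_meas: "(\<lambda>(\<omega>, t). y t \<omega>) \<in> borel_measurable (M \<Otimes>\<^sub>M I)"
    unfolding y by (rule borel_measurable_running_integral[OF x_meas])
  have x2: "integrable (M \<Otimes>\<^sub>M I) (\<lambda>(\<omega>, t). (norm (x t \<omega>))\<^sup>2)"
    by (rule finite_expected_time_integral_iff_integrable[THEN iffD1, OF _ _ x_int])
       (use x_meas in \<open>simp_all add: case_prod_unfold\<close>)
  have P2y2: "integrable (M \<Otimes>\<^sub>M I) (\<lambda>(\<omega>, t). (norm (P' t \<omega>))\<^sup>2 * (norm (y t \<omega>))\<^sup>2)"
  proof (rule finite_expected_time_integral_iff_integrable[THEN iffD1])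
    show "finite_expected_time_integral T M (\<lambda>t \<omega>. (norm (P' t \<omega>))\<^sup>2 * (norm (y t \<omega>))\<^sup>2)"
      by (rule finite_expected_time_integral_cong[THEN iffD1, OF _ Py_int])
         (use eq in eventually_elim, simp)
  qed (use P' y_meas in \<open>simp_all add: case_prod_unfold\<close>)
  have Q2P2_meas: "(\<lambda>(\<omega>, t). \<eta> * (Q0 \<bullet> P' t \<omega>)\<^sup>2) \<in> borel_measurable (M \<Otimes>\<^sub>M I)"
    using P' by (simp add: case_prod_unfold)
  have Q2P2: "integrable (M \<Otimes>\<^sub>M I) (\<lambda>(\<omega>, t). \<eta> * (Q0 \<bullet> P' t \<omega>)\<^sup>2)"
  proof (cases "N = 0")
    case True
    show ?thesis
    proof (rule finite_expected_time_integral_iff_integrable[THEN iffD1, OF Q2P2_meas])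
      show "finite_expected_time_integral T M (\<lambda>t \<omega>. \<eta> * (Q0 \<bullet> P' t \<omega>)\<^sup>2)"
        by (rule finite_expected_time_integral_cong[THEN iffD1, OF _ P_int_N0[OF True]])
           (use eq in eventually_elim, simp)
    qed (use nonneg in simp)
  next
    case False
    \<comment> \<open>Readouts in coordinates with respect to the arbitrary basis: \<open>?a\<close>
      returns the level-0 coefficient, and \<open>?E\<close> the level-1 coefficients, which are
      present because \<open>N\<close> is not 0.\<close>
    let ?a = "\<chi> j. e j []" and ?E = "\<chi> i j. e j [i]"
    have y_lower: "AE \<omega> in M. \<forall>t\<in>{0..T}. t \<le> norm ?a * norm (y t \<omega>)"
      using running_integral_bounds(1)[OF x_meas x2 y] signature
    proof eventually_elim
      case (elim \<omega>)
      show ?case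
      proof
        fix t assume t: "t \<in> {0..T}"
        have A: "{0..t} \<in> sets I" using t by (auto simp: sets_restrict_space_iff)
        then have "integrable I (\<lambda>u. indicator {0..t} u *\<^sub>R x u \<omega>)"
          using elim(1) by (rule integrable_mult_indicator)
        from integral_bounded_linear[OF bounded_linear_inner_left this, of ?a]
        have "y t \<omega> \<bullet> ?a = (\<integral>u. (indicator {0..t} u *\<^sub>R x u \<omega>) \<bullet> ?a \<partial>I)"
          using t by (simp only: y set_integral_initial_eq_I atLeastAtMost_iff)
        also have "\<dots> = (\<integral>u. indicator {0..t} u \<partial>I)"
        proof (rule Bochner_Integration.integral_cong[OF refl])
          fix u assume "u \<in> space I"
          then have "x u \<omega> \<bullet> ?a = 1"
            unfolding x by (intro signature_coords_level_0[OF e elim(2)]) (auto simp: space_I)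
          then show "(indicator {0..t} u *\<^sub>R x u \<omega>) \<bullet> ?a = indicator {0..t} u" by simp
        qed
        also have "\<dots> = t" using integral_indicator_I[of 0 t] t by simp
        finally show "t \<le> norm ?a * norm (y t \<omega>)"
          using norm_cauchy_schwarz[of "y t \<omega>" ?a] by (simp add: mult.commute)
      qed
    qed
    \<comment> \<open>On almost every path this composite sends x_t to P_t - P_0, so its operator
      bound is the constant \<open>k\<close> of the increment estimate.\<close>
    have "bounded_linear (\<lambda>u. \<pi>P (?E *v u))"
      using \<pi>P by (intro bounded_linear_compose[OF _ matrix_vector_mul_bounded_linear])
        (simp add: linear_conv_bounded_linear)
    then obtain k where k: "\<And>u. norm (\<pi>P (?E *v u)) \<le> norm u * k"
      using bounded_linear.bounded by blast
    have increment: "AE \<omega> in M. \<forall>t\<in>{0..T}. norm (P' t \<omega> - P' 0 \<omega>) \<le> k * norm (x t \<omega>)"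
      using signature lift_level1 eq
    proof eventually_elim
      case (elim \<omega>)
      show ?case
      proof
        fix t assume t: "t \<in> {0..T}"
        have "(?E *v x t \<omega>) $ i = (Z t \<omega> - Z 0 \<omega>) $ i" for i
          using signature_coords_level_1[OF e elim(1) _ _ False p, of t i] elim(2) t by (simp add: x)
        then have "?E *v x t \<omega> = Z t \<omega> - Z 0 \<omega>" by (intro vec_eq_iff[THEN iffD2] allI)
        then have "\<pi>P (?E *v x t \<omega>) = P t \<omega> - P 0 \<omega>" by (simp add: P linear_diff[OF \<pi>P])
        then show "norm (P' t \<omega> - P' 0 \<omega>) \<le> k * norm (x t \<omega>)"
          using k[of "x t \<omega>"] elim(3) t T by (simp add: mult.commute)
      qed
    qed
    have "integrable (M \<Otimes>\<^sub>M I) (\<lambda>z. (norm (P' (snd z) (fst z)))\<^sup>2)"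
      using integrable_price_power2[OF P' x2 P2y2 y_lower increment] by (simp add: case_prod_unfold)
    from integrable_mult_right[OF this, of "\<eta> * (norm Q0)\<^sup>2"] Q2P2_meas show ?thesis
    proof (rule Bochner_Integration.integrable_bound)
      have "\<eta> * (Q0 \<bullet> w)\<^sup>2 \<le> \<eta> * (norm Q0)\<^sup>2 * (norm w)\<^sup>2" for w
        using mult_left_mono[OF Cauchy_Schwarz_ineq[of Q0 w] nonneg(2)]
        by (simp add: power2_norm_eq_inner mult.assoc)
      then show "AE z in M \<Otimes>\<^sub>M I. norm (case z of (\<omega>, t) \<Rightarrow> \<eta> * (Q0 \<bullet> P' t \<omega>)\<^sup>2)
          \<le> norm (\<eta> * (norm Q0)\<^sup>2 * (norm (P' (snd z) (fst z)))\<^sup>2)"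
        using nonneg(2) by (intro AE_I2) (simp add: case_prod_unfold)
    qed
  qed
  have sym: "transpose \<Lambda> = \<Lambda>" "transpose \<Sigma>' = \<Sigma>'"
    using \<Lambda> \<Sigma>' by (auto simp: sym_pos_def_def sym_pos_semidef_def)
  note main = quadratic_objective[OF x_meas P' eq y x2 P2y2 Q2P2 nonneg(1,2) sym]
  show ?thesis
  proof (intro conjI allI exI)
    let ?A = "- integral\<^sup>L M (quadratic_rv T \<Lambda> \<Sigma>' \<phi> \<eta> \<gamma> P x y)"
    show "transpose ?A = ?A"
      by (simp add: main(6) linear_neg[OF bounded_linear.linear[OF bounded_linear_transpose]])
    fix B
    show "J B = colvec B \<bullet> (?A *v colvec B)
        + integral\<^sup>L M (linear_rv T \<Sigma>' \<phi> \<eta> \<gamma> Q0 K P x y) \<bullet> colvec B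
        + integral\<^sup>L M (constant_rv T \<Sigma>' \<phi> \<eta> \<gamma> Q0 K P x)"
      unfolding J main(5)
      by (simp add: linear_neg[OF bounded_linear.linear[OF bounded_linear_quadratic_form]])
  qed (rule main refl)+
qed

end
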